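(* Let $\Theta=(\Theta_1,\dots,\Theta_N)$ be an $N$-tuple of pairwise commuting symmetric positive definite $n\times n$ matrices and let $X=(X_t)_{t\in\mathbb{Z}^N}$ be an $\mathbb{R}^n$-valued field. Suppose (i) for every $j\in\{1,\dots,N\}$ and all $t_1,\dots,t_{j-1},t_{j+1},\dots,t_N\in\mathbb{Z}$, $e^{m\Theta_j}X_{t_1,\dots,t_{j-1},m,t_{j+1},\dots,t_N}\to0$ in probability as $m\to-\infty$; (ii) there is $G\in\mathcal{G}_\Theta$ such that $$X_t=\sum_{i\in\{0,1\}^N,\,i\ne\mathbf 0}(-1)^{1+i_1+\dots+i_N}e^{-i\ast\Theta}X_{t_1-i_1,\dots,t_N-i_N}+\Delta_tG,\qquad t\in\mathbb{Z}^N.$$ Then $X$ is stationary and $X=(\mathcal{L}^{-1}_\Theta\circ\mathcal{M}^{-1}_\Theta)(G)$, i.e. $X_t=e^{-t\ast\Theta}\sum_{j=-\infty}^te^{j\ast\Theta}\Delta_jG$ for all $t$.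
   Context: $t\ast\Theta=\sum_{j=1}^N t_j\Theta_j$. Equality in law of fields means equality of all finite-dimensional distributions. $X$ is stationary if $(X_{t+s})_t$ and $(X_t)_t$ are equal in law for every $s\in\mathbb{Z}^N$. For a field $Z=(Z_t)_{t\in\mathbb{Z}^N}$, $\Delta_t Z=\sum_{i\in\{0,1\}^N}(-1)^{i_1+\dots+i_N}Z_{t_1-i_1,\dots,t_N-i_N}$. $G$ is a stationary increment field if $(\Delta_{t+s}G)_{t}$ and $(\Delta_tG)_{t}$ are equal in law for every $s$. $\mathcal{G}_\Theta$ is the class of stationary increment fields $G$ such that $\sum_{j=-\infty}^te^{j\ast\Theta}\Delta_jG:=\lim_{M_1\to\infty}\cdots\lim_{M_N\to\infty}\sum_{j_1=-M_1}^{t_1}\cdots\sum_{j_N=-M_N}^{t_N}e^{j\ast\Theta}\Delta_jG$ converges in probability for every $t$. $(\mathcal{M}^{-1}_\Theta G)_{e^t}=\sum_{j=-\infty}^te^{j\ast\Theta}\Delta_jG$ and $(\mathcal{L}^{-1}_\Theta Y)_t=e^{-t\ast\Theta}Y_{e^t}$. *)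

theory Defs
  imports "HOL-Probability.Probability"
begin

text \<open>Index set Z^N: functions nat => int vanishing from coordinate N on.
  Coordinates 0..N-1 correspond to t_1..t_N.\<close>
definition ZN :: "nat \<Rightarrow> (nat \<Rightarrow> int) set" where
  "ZN N = {t. \<forall>k\<ge>N. t k = 0}"

text \<open>The set {0,1}^N.\<close>
definition BN :: "nat \<Rightarrow> (nat \<Rightarrow> int) set" where
  "BN N = {i. (\<forall>k<N. i k = 0 \<or> i k = 1) \<and> (\<forall>k\<ge>N. i k = 0)}"

definition idx_diff :: "(nat \<Rightarrow> int) \<Rightarrow> (nat \<Rightarrow> int) \<Rightarrow> (nat \<Rightarrow> int)" where
  "idx_diff t i = (\<lambda>k. t k - i k)"

definition idx_add :: "(nat \<Rightarrow> int) \<Rightarrow> (nat \<Rightarrow> int) \<Rightarrow> (nat \<Rightarrow> int)" where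
  "idx_add t s = (\<lambda>k. t k + s k)"

definition sign_of :: "nat \<Rightarrow> (nat \<Rightarrow> int) \<Rightarrow> real" where
  "sign_of N i = (-1) ^ nat (\<Sum>k<N. i k)"

text \<open>Matrix powers and matrix exponential.\<close>
definition mat_pow :: "real^'n^'n \<Rightarrow> nat \<Rightarrow> real^'n^'n" where
  "mat_pow A k = (((**) A) ^^ k) (mat 1)"

definition mexp :: "real^'n^'n \<Rightarrow> real^'n^'n" where
  "mexp A = (\<Sum>k. (1 / fact k) *\<^sub>R mat_pow A k)"

text \<open>t * Theta = sum_j t_j Theta_j\<close>
definition tTheta :: "nat \<Rightarrow> (nat \<Rightarrow> real^'n^'n) \<Rightarrow> (nat \<Rightarrow> int) \<Rightarrow> real^'n^'n" where
  "tTheta N Th t = (\<Sum>j<N. real_of_int (t j) *\<^sub>R Th j)"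

text \<open>Increment operator Delta_t Z (pointwise in omega).\<close>
definition Delta :: "nat \<Rightarrow> ((nat \<Rightarrow> int) \<Rightarrow> 'a \<Rightarrow> real^'n) \<Rightarrow> (nat \<Rightarrow> int) \<Rightarrow> 'a \<Rightarrow> real^'n" where
  "Delta N Z t \<omega> = (\<Sum>i\<in>BN N. sign_of N i *\<^sub>R Z (idx_diff t i) \<omega>)"

text \<open>Convergence in probability of a sequence of random vectors.\<close>
definition conv_prob :: "'a measure \<Rightarrow> (nat \<Rightarrow> 'a \<Rightarrow> 'b::real_normed_vector) \<Rightarrow> ('a \<Rightarrow> 'b) \<Rightarrow> bool" where
  "conv_prob M Y Z \<longleftrightarrow> (\<forall>k. Y k \<in> borel_measurable M) \<and> Z \<in> borel_measurable M \<and>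
     (\<forall>e>0. (\<lambda>k. measure M {\<omega>\<in>space M. e < norm (Y k \<omega> - Z \<omega>)}) \<longlonglongrightarrow> 0)"

text \<open>Iterated limit in probability lim_{M_1} ... lim_{M_N} F(M_1,...,M_N) = Y:
  there are intermediate limits L k (depending on M_1..M_k), L N = F, and
  L k is the limit in probability of L (k+1) as M_{k+1} tends to infinity.\<close>
definition iter_lim_prob :: "'a measure \<Rightarrow> nat \<Rightarrow> ((nat \<Rightarrow> nat) \<Rightarrow> 'a \<Rightarrow> 'b::real_normed_vector) \<Rightarrow> ('a \<Rightarrow> 'b) \<Rightarrow> bool" where
  "iter_lim_prob M N F Y \<longleftrightarrow> (\<exists>L. (\<forall>Mv. L N Mv = F Mv) \<and>
     (\<forall>k<N. \<forall>Mv. conv_prob M (\<lambda>m. L (Suc k) (Mv(k := m))) (L k Mv)) \<and>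
     Y = L 0 (\<lambda>_. 0))"

text \<open>Truncated box {j : -M_k <= j_k <= t_k for all k < N}.\<close>
definition box :: "nat \<Rightarrow> (nat \<Rightarrow> int) \<Rightarrow> (nat \<Rightarrow> nat) \<Rightarrow> (nat \<Rightarrow> int) set" where
  "box N t Mv = {j\<in>ZN N. \<forall>k<N. - int (Mv k) \<le> j k \<and> j k \<le> t k}"

text \<open>Y is (a version of) (M_Theta^{-1} G)_{e^t}.\<close>
definition Minv_at :: "'a measure \<Rightarrow> nat \<Rightarrow> (nat \<Rightarrow> real^'n^'n) \<Rightarrow> ((nat \<Rightarrow> int) \<Rightarrow> 'a \<Rightarrow> real^'n)
    \<Rightarrow> (nat \<Rightarrow> int) \<Rightarrow> ('a \<Rightarrow> real^'n) \<Rightarrow> bool" where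
  "Minv_at M N Th G t Y \<longleftrightarrow>
     iter_lim_prob M N (\<lambda>Mv \<omega>. \<Sum>j\<in>box N t Mv. mexp (tTheta N Th j) *v Delta N G j \<omega>) Y"

text \<open>Equality in law (all finite-dimensional distributions) of two fields on Z^N.\<close>
definition eq_law :: "'a measure \<Rightarrow> nat \<Rightarrow> ((nat \<Rightarrow> int) \<Rightarrow> 'a \<Rightarrow> real^'n) \<Rightarrow> ((nat \<Rightarrow> int) \<Rightarrow> 'a \<Rightarrow> real^'n) \<Rightarrow> bool" where
  "eq_law M N X Y \<longleftrightarrow> (\<forall>T. finite T \<and> T \<subseteq> ZN N \<longrightarrow>
     distr M (PiM T (\<lambda>_. borel)) (\<lambda>\<omega>. restrict (\<lambda>t. X t \<omega>) T) =
     distr M (PiM T (\<lambda>_. borel)) (\<lambda>\<omega>. restrict (\<lambda>t. Y t \<omega>) T))"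

definition stationary :: "'a measure \<Rightarrow> nat \<Rightarrow> ((nat \<Rightarrow> int) \<Rightarrow> 'a \<Rightarrow> real^'n) \<Rightarrow> bool" where
  "stationary M N X \<longleftrightarrow> (\<forall>s\<in>ZN N. eq_law M N (\<lambda>t. X (idx_add t s)) X)"

definition stat_incr :: "'a measure \<Rightarrow> nat \<Rightarrow> ((nat \<Rightarrow> int) \<Rightarrow> 'a \<Rightarrow> real^'n) \<Rightarrow> bool" where
  "stat_incr M N G \<longleftrightarrow> (\<forall>s\<in>ZN N. eq_law M N (\<lambda>t. Delta N G (idx_add t s)) (\<lambda>t. Delta N G t))"

text \<open>The class G_Theta.\<close>
definition G_class :: "'a measure \<Rightarrow> nat \<Rightarrow> (nat \<Rightarrow> real^'n^'n) \<Rightarrow> ((nat \<Rightarrow> int) \<Rightarrow> 'a \<Rightarrow> real^'n) \<Rightarrow> bool" where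
  "G_class M N Th G \<longleftrightarrow> stat_incr M N G \<and> (\<forall>t\<in>ZN N. \<exists>Y. Minv_at M N Th G t Y)"

definition sym_posdef :: "real^'n^'n \<Rightarrow> bool" where
  "sym_posdef A \<longleftrightarrow> transpose A = A \<and> (\<forall>x. x \<noteq> 0 \<longrightarrow> x \<bullet> (A *v x) > 0)"

end

theory Submission
  imports Defs
begin

text \<open>
  Put \<open>Z\<^sub>t = e\<^bsup>t*\<Theta>\<^esup> X\<^sub>t\<close>. Since the \<open>\<Theta>\<^sub>j\<close> commute, the recursion says
  \<open>\<Delta>\<^sub>t Z = e\<^bsup>t*\<Theta>\<^esup> \<Delta>\<^sub>t G\<close>, and summing over a box \<open>a < j \<le> t\<close> telescopes to an alternating sum of
  \<open>Z\<close> over the corners of the box. By hypothesis (i) the corners with some coordinate equal to \<open>a\<^sub>k\<close> vanish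
  in the iterated limit, one coordinate after the other, which leaves \<open>Z\<^sub>t\<close>.

  For stationarity, box sums with a common, suitably chosen sequence of lower corners converge almost surely
  to \<open>X\<close> and to the shifted field simultaneously on any finite index set. The two approximations are
  the same function of \<open>(\<Delta>\<^sub>j G)\<^sub>j\<close> and of \<open>(\<Delta>\<^bsub>j+s\<^esub> G)\<^sub>j\<close>, so they have equal laws, and so have their limits.
\<close>

section \<open>The matrix exponential\<close>

lemma matrix_add_rdistrib:
  fixes A B :: "'a::semiring_1^'n^'m"
  shows "(A + B) ** C = A ** C + B ** C"
  by (simp add: matrix_matrix_mult_def vec_eq_iff sum.distrib distrib_right)

lemma matrix_mult_sum_left:
  fixes A :: "'i \<Rightarrow> 'a::semiring_1^'n^'m"
  shows "(\<Sum>i\<in>I. A i) ** B = (\<Sum>i\<in>I. A i ** B)"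
  by (induction I rule: infinite_finite_induct) (auto simp: matrix_add_rdistrib)

lemma matrix_mult_sum_right:
  fixes B :: "'i \<Rightarrow> 'a::semiring_1^'n^'m"
  shows "A ** (\<Sum>i\<in>I. B i) = (\<Sum>i\<in>I. A ** B i)"
  by (induction I rule: infinite_finite_induct) (auto simp: matrix_add_ldistrib)

lemma matrix_vector_mult_sum_right:
  fixes A :: "real^'n^'m"
  shows "A *v (\<Sum>i\<in>I. x i) = (\<Sum>i\<in>I. A *v x i)"
  by (induction I rule: infinite_finite_induct) (auto simp: matrix_vector_right_distrib)

lemma mat_pow_0 [simp]: "mat_pow A 0 = mat 1"
  by (simp add: mat_pow_def)

lemma mat_pow_Suc: "mat_pow A (Suc k) = A ** mat_pow A k"
  by (simp add: mat_pow_def)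

lemma mat_pow_commute:
  assumes "A ** B = B ** A"
  shows "mat_pow A k ** B = B ** mat_pow A k"
proof (induction k)
  case (Suc k)
  have "mat_pow A (Suc k) ** B = A ** (B ** mat_pow A k)"
    by (simp add: mat_pow_Suc Suc flip: matrix_mul_assoc)
  also have "\<dots> = B ** mat_pow A (Suc k)"
    by (simp add: mat_pow_Suc assms matrix_mul_assoc)
  finally show ?case .
qed simp

text \<open>The operator norm is submultiplicative. This bound lets the scalar exponential series
  dominate every entry of the matrix series.\<close>

lemma onorm_mat_pow_le: "onorm ((*v) (mat_pow A k)) \<le> onorm ((*v) A) ^ k" for A :: "real^'n^'n"
proof (induction k)
  case 0
  have "(*v) (mat 1 :: real^'n^'n) = (\<lambda>x. x)" by auto
  then show ?case by (simp add: onorm_id_le)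
next
  case (Suc k)
  have "(*v) (mat_pow A (Suc k)) = (*v) A \<circ> (*v) (mat_pow A k)"
    by (auto simp: mat_pow_Suc matrix_vector_mul_assoc)
  then have "onorm ((*v) (mat_pow A (Suc k))) \<le> onorm ((*v) A) * onorm ((*v) (mat_pow A k))"
    by (simp add: onorm_compose)
  also have "\<dots> \<le> onorm ((*v) A) ^ Suc k"
    using Suc by (simp add: mult_left_mono onorm_pos_le)
  finally show ?case .
qed

lemma summable_mat_pow_component:
  fixes A :: "real^'n^'n"
  shows "summable (\<lambda>k. norm ((1 / fact k) * mat_pow A k $ i $ j))"
proof (rule summable_comparison_test')
  show "summable (\<lambda>k. onorm ((*v) A) ^ k /\<^sub>R fact k)"
    by (rule summable_exp_generic)
  fix k :: nat
  have "\<bar>mat_pow A k $ i $ j\<bar> \<le> onorm ((*v) A) ^ k"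
    using matrix_component_le_onorm onorm_mat_pow_le by (rule order_trans)
  then show "norm (norm ((1 / fact k) * mat_pow A k $ i $ j)) \<le> onorm ((*v) A) ^ k /\<^sub>R fact k"
    by (simp add: abs_mult field_simps)
qed

text \<open>Matrix limits are taken entrywise, so the defining series can be read as one absolutely
  convergent scalar series per entry. Results on scalar series then apply to
  \<open>mexp\<close>.\<close>

lemma mexp_component:
  fixes A :: "real^'n^'n"
  shows "mexp A $ i $ j = (\<Sum>k. (1 / fact k) * mat_pow A k $ i $ j)"
proof -
  have "(\<lambda>k. (1 / fact k) *\<^sub>R mat_pow A k) sums (\<chi> i j. \<Sum>k. (1 / fact k) * mat_pow A k $ i $ j)"
    unfolding sums_def
  proof (intro vec_tendstoI)
    fix i j
    show "((\<lambda>n. (\<Sum>k<n. (1 / fact k) *\<^sub>R mat_pow A k) $ i $ j) \<longlongrightarrow>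
            (\<chi> i j. \<Sum>k. (1 / fact k) * mat_pow A k $ i $ j) $ i $ j) sequentially"
      using summable_LIMSEQ[OF summable_norm_cancel[OF summable_mat_pow_component[of A i j]]]
      by simp
  qed
  then show ?thesis
    unfolding mexp_def by (simp add: sums_unique[symmetric])
qed

lemma mexp_0 [simp]: "mexp 0 = (mat 1 :: real^'n^'n)"
proof -
  have "mat_pow (0::real^'n^'n) k = 0" if "k \<noteq> 0" for k
    using that by (cases k) (auto simp: mat_pow_Suc)
  then have "(\<Sum>k. (1 / fact k) *\<^sub>R mat_pow (0::real^'n^'n) k) = (\<Sum>k\<in>{0}. (1 / fact k) *\<^sub>R mat_pow 0 k)"
    by (intro suminf_finite) auto
  then show ?thesis
    by (simp add: mexp_def)
qed

text \<open>Binomial theorem for commuting matrices, written with divided powers: no binomial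
  coefficients occur, and the right-hand side is already the n-th term of a Cauchy product.\<close>

lemma mat_pow_add_commuting:
  fixes A B :: "real^'n^'n"
  assumes comm: "A ** B = B ** A"
  shows "(1 / fact n) *\<^sub>R mat_pow (A + B) n =
    (\<Sum>i\<le>n. ((1 / fact i) *\<^sub>R mat_pow A i) ** ((1 / fact (n - i)) *\<^sub>R mat_pow B (n - i)))"
proof -
  define S :: "real^'n^'n \<Rightarrow> nat \<Rightarrow> real^'n^'n" where "S A n = (1 / fact n) *\<^sub>R mat_pow A n" for A n
  \<comment> \<open>Multiplying a divided power by its base raises the index at the cost of a factor
    \<open>Suc n\<close>. Together with \<open>S_comm\<close> this drives the induction.\<close>
  have mult_S: "A ** S A n = real (Suc n) *\<^sub>R S A (Suc n)" for A n
    by (simp add: S_def mat_pow_Suc matrix_scalar_ac del: of_nat_Suc flip: scalar_matrix_assoc)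
  have S_comm: "B ** S A i = S A i ** B" for i
    by (simp add: S_def matrix_scalar_ac mat_pow_commute[OF comm] flip: scalar_matrix_assoc)
  have "S (A + B) n = (\<Sum>i\<le>n. S A i ** S B (n - i))"
  proof (induction n)
    case 0
    show ?case by (simp add: S_def)
  next
    case (Suc n)
    let ?T = "\<lambda>i. S A i ** S B (Suc n - i)"
    have "A ** (\<Sum>i\<le>n. S A i ** S B (n - i)) = (\<Sum>i\<le>n. real (Suc i) *\<^sub>R ?T (Suc i))"
      by (simp add: matrix_mult_sum_right matrix_mul_assoc mult_S flip: scalar_matrix_assoc)
    \<comment> \<open>The new index 0 carries weight 0; in the sum for \<open>B\<close> below, the
      same happens at the other end.\<close>
    also have "\<dots> = (\<Sum>i\<le>Suc n. real i *\<^sub>R ?T i)"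
      by (subst sum.atMost_Suc_shift) simp
    finally have left: "A ** (\<Sum>i\<le>n. S A i ** S B (n - i)) = (\<Sum>i\<le>Suc n. real i *\<^sub>R ?T i)" .
    have "B ** (\<Sum>i\<le>n. S A i ** S B (n - i)) = (\<Sum>i\<le>n. S A i ** (B ** S B (n - i)))"
      by (simp add: matrix_mult_sum_right matrix_mul_assoc S_comm)
    also have "\<dots> = (\<Sum>i\<le>n. real (Suc n - i) *\<^sub>R ?T i)"
      by (intro sum.cong refl) (simp add: mult_S matrix_scalar_ac Suc_diff_le flip: scalar_matrix_assoc)
    also have "\<dots> = (\<Sum>i\<le>Suc n. real (Suc n - i) *\<^sub>R ?T i)"
      by simp
    finally have right: "B ** (\<Sum>i\<le>n. S A i ** S B (n - i)) = (\<Sum>i\<le>Suc n. real (Suc n - i) *\<^sub>R ?T i)" .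
    have "real (Suc n) *\<^sub>R S (A + B) (Suc n) = (A + B) ** (\<Sum>i\<le>n. S A i ** S B (n - i))"
      using mult_S[of "A + B" n] Suc by simp
    also have "\<dots> = (\<Sum>i\<le>Suc n. real i *\<^sub>R ?T i + real (Suc n - i) *\<^sub>R ?T i)"
      unfolding matrix_add_rdistrib left right by (rule sum.distrib[symmetric])
    \<comment> \<open>The weights \<open>i\<close> and \<open>Suc n - i\<close> add up to the
      constant \<open>Suc n\<close>, which is cancelled at the end.\<close>
    also have "\<dots> = (\<Sum>i\<le>Suc n. real (Suc n) *\<^sub>R ?T i)"
      by (intro sum.cong refl) (simp flip: scaleR_add_left of_nat_add)
    also have "\<dots> = real (Suc n) *\<^sub>R (\<Sum>i\<le>Suc n. ?T i)"
      by (rule scaleR_sum_right[symmetric])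
    finally show ?case by (simp del: sum.atMost_Suc of_nat_Suc)
  qed
  then show ?thesis by (simp add: S_def)
qed

text \<open>Each entry of the product is a finite sum over \<open>l\<close> of products of
  absolutely convergent scalar series. The Cauchy product merges each pair into one series, the sum
  over \<open>l\<close> moves inside, and the k-th term is then an entry of the binomial
  formula.\<close>

lemma mexp_add_commuting:
  fixes A B :: "real^'n^'n"
  assumes "A ** B = B ** A"
  shows "mexp (A + B) = mexp A ** mexp B"
proof -
  have "mexp (A + B) $ i $ j = (mexp A ** mexp B) $ i $ j" for i j
  proof -
    define a where "a l k = (1 / fact k) * mat_pow A k $ i $ l" for l k
    define b where "b l k = (1 / fact k) * mat_pow B k $ l $ j" for l k
    have sa: "summable (\<lambda>k. norm (a l k))" and sb: "summable (\<lambda>k. norm (b l k))" for l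
      unfolding a_def b_def by (rule summable_mat_pow_component)+
    have "(mexp A ** mexp B) $ i $ j = (\<Sum>l\<in>UNIV. (\<Sum>k. a l k) * (\<Sum>k. b l k))"
      by (simp add: matrix_matrix_mult_def mexp_component a_def b_def)
    also have "\<dots> = (\<Sum>l\<in>UNIV. \<Sum>k. \<Sum>m\<le>k. a l m * b l (k - m))"
      by (simp add: Cauchy_product[OF sa sb])
    also have "\<dots> = (\<Sum>k. \<Sum>l\<in>UNIV. \<Sum>m\<le>k. a l m * b l (k - m))"
      by (intro suminf_sum[symmetric] summable_Cauchy_product sa sb)
    also have "(\<lambda>k. \<Sum>l\<in>UNIV. \<Sum>m\<le>k. a l m * b l (k - m)) =
        (\<lambda>k. (1 / fact k) * mat_pow (A + B) k $ i $ j)"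
    proof
      fix k
      have "(1 / fact k) * mat_pow (A + B) k $ i $ j = ((1 / fact k) *\<^sub>R mat_pow (A + B) k) $ i $ j"
        by simp
      also have "\<dots> = (\<Sum>m\<le>k. \<Sum>l\<in>UNIV. a l m * b l (k - m))"
        by (simp add: mat_pow_add_commuting[OF assms] matrix_matrix_mult_def a_def b_def del: vector_scaleR_component)
          (simp add: field_simps)
      also have "\<dots> = (\<Sum>l\<in>UNIV. \<Sum>m\<le>k. a l m * b l (k - m))"
        by (rule sum.swap)
      finally show "(\<Sum>l\<in>UNIV. \<Sum>m\<le>k. a l m * b l (k - m)) = (1 / fact k) * mat_pow (A + B) k $ i $ j"
        by simp
    qed
    finally show ?thesis by (simp add: mexp_component)
  qed
  then show ?thesis by (simp add: vec_eq_iff)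
qed

section \<open>Increments and telescoping over boxes\<close>

lemma ZN_fun_upd: "t \<in> ZN N \<Longrightarrow> k < N \<Longrightarrow> t(k := m) \<in> ZN N"
  by (auto simp: ZN_def)

lemma idx_add_in_ZN: "t \<in> ZN N \<Longrightarrow> s \<in> ZN N \<Longrightarrow> idx_add t s \<in> ZN N"
  by (auto simp: ZN_def idx_add_def)

lemma idx_diff_in_ZN: "t \<in> ZN N \<Longrightarrow> i \<in> BN N \<Longrightarrow> idx_diff t i \<in> ZN N"
  by (auto simp: ZN_def BN_def idx_diff_def)

lemma idx_add_0 [simp]: "idx_add t (\<lambda>_. 0) = t"
  by (simp add: idx_add_def)

lemma tTheta_add: "tTheta N Th (idx_add t s) = tTheta N Th t + tTheta N Th s"
  by (simp add: tTheta_def idx_add_def scaleR_add_left sum.distrib)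

lemma tTheta_diff: "tTheta N Th (idx_diff t s) = tTheta N Th t - tTheta N Th s"
  by (simp add: tTheta_def idx_diff_def scaleR_diff_left sum_subtractf)

lemma tTheta_0 [simp]: "tTheta N Th (\<lambda>_. 0) = 0"
  by (simp add: tTheta_def)

lemma tTheta_single: "j < N \<Longrightarrow> tTheta N Th ((\<lambda>_. 0)(j := m)) = real_of_int m *\<^sub>R Th j"
  by (simp add: tTheta_def if_distrib[of real_of_int] if_distribR cong: if_cong)
    (simp add: if_distrib[of "\<lambda>x. x *\<^sub>R _"] sum.delta cong: if_cong)

lemma tTheta_commute:
  assumes "\<forall>i<N. \<forall>j<N. Th i ** Th j = Th j ** Th i"
  shows "tTheta N Th t ** tTheta N Th s = tTheta N Th s ** tTheta N Th t"
proof -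
  have *: "tTheta N Th t ** tTheta N Th s =
      (\<Sum>j<N. \<Sum>i<N. (real_of_int (s j) * real_of_int (t i)) *\<^sub>R (Th i ** Th j))" for t s
    by (simp add: tTheta_def matrix_mult_sum_left matrix_mult_sum_right matrix_scalar_ac
        scaleR_sum_right flip: scalar_matrix_assoc)
  have "tTheta N Th t ** tTheta N Th s =
      (\<Sum>i<N. \<Sum>j<N. (real_of_int (s j) * real_of_int (t i)) *\<^sub>R (Th i ** Th j))"
    unfolding * by (rule sum.swap)
  also have "\<dots> = tTheta N Th s ** tTheta N Th t"
    unfolding *[of s t] using assms by (intro sum.cong refl) (auto simp: mult.commute)
  finally show ?thesis .
qed

lemma mexp_tTheta_add:
  assumes "\<forall>i<N. \<forall>j<N. Th i ** Th j = Th j ** Th i"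
  shows "mexp (tTheta N Th (idx_add t s)) = mexp (tTheta N Th t) ** mexp (tTheta N Th s)"
  unfolding tTheta_add by (intro mexp_add_commuting tTheta_commute assms)

text \<open>Both orders of the factors are used: the coefficients of the recursion stand on the
  right of the weight, the normalisation in the stationarity proof on the left.\<close>

lemma mexp_tTheta_diff:
  assumes "\<forall>i<N. \<forall>j<N. Th i ** Th j = Th j ** Th i"
  shows "mexp (tTheta N Th (idx_diff t s)) = mexp (tTheta N Th t) ** mexp (- tTheta N Th s)"
    and "mexp (tTheta N Th (idx_diff t s)) = mexp (- tTheta N Th s) ** mexp (tTheta N Th t)"
proof -
  let ?s = "idx_diff (\<lambda>_. 0) s"
  have "idx_diff t s = idx_add t ?s" "idx_diff t s = idx_add ?s t"
    by (auto simp: idx_add_def idx_diff_def)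
  moreover have "tTheta N Th ?s = - tTheta N Th s"
    by (simp add: tTheta_diff)
  ultimately show "mexp (tTheta N Th (idx_diff t s)) = mexp (tTheta N Th t) ** mexp (- tTheta N Th s)"
    "mexp (tTheta N Th (idx_diff t s)) = mexp (- tTheta N Th s) ** mexp (tTheta N Th t)"
    using mexp_tTheta_add[OF assms, of t ?s] mexp_tTheta_add[OF assms, of ?s t] by simp_all
qed

lemma mexp_uminus_mult: "mexp (- A) ** mexp A = (mat 1 :: real^'n^'n)"
proof -
  have "(- A) ** A = A ** (- A)"
    using matrix_scalar_ac[of A "-1" A] scalar_matrix_assoc[of "-1" A A] by simp
  from mexp_add_commuting[OF this] show ?thesis by simp
qed

section \<open>Increments by induction on the dimension\<close>

lemma BN_0: "BN 0 = {\<lambda>_. 0}"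
  by (auto simp: BN_def)

lemma zero_in_BN: "(\<lambda>_. 0) \<in> BN N"
  by (simp add: BN_def)

lemma BN_Suc: "BN (Suc N) = BN N \<union> (\<lambda>i. i(N := 1)) ` BN N"
proof (intro equalityI subsetI)
  fix i assume i: "i \<in> BN (Suc N)"
  then have "i N = 0 \<or> i N = 1" by (simp add: BN_def)
  then show "i \<in> BN N \<union> (\<lambda>i. i(N := 1)) ` BN N"
  proof
    assume "i N = 0"
    have "i k = 0" if "k \<ge> N" for k
      using i that \<open>i N = 0\<close> by (cases "k = N") (auto simp: BN_def)
    with i show ?thesis by (simp add: BN_def)
  next
    assume "i N = 1"
    then have "i = (i(N := 0))(N := 1)" by auto
    moreover have "i(N := 0) \<in> BN N" using i by (auto simp: BN_def)
    ultimately show ?thesis by blast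
  qed
qed (auto simp: BN_def less_Suc_eq)

lemma finite_BN: "finite (BN N)"
  by (induction N) (auto simp: BN_0 BN_Suc)

lemma Delta_0: "Delta 0 Z t \<omega> = Z t \<omega>"
  by (simp add: Delta_def BN_0 sign_of_def idx_diff_def)

text \<open>Pairing each \<open>i\<close> with \<open>i(N := 1)\<close> flips the sign and lowers
  coordinate \<open>N\<close> of the argument by one. The mixed increment is thus an iterated
  one-dimensional difference, which allows induction on \<open>N\<close>.\<close>

lemma Delta_Suc: "Delta (Suc N) Z t \<omega> = Delta N Z t \<omega> - Delta N Z (t(N := t N - 1)) \<omega>"
proof -
  have vanish: "i N = 0" if "i \<in> BN N" for i using that by (simp add: BN_def)
  have inj: "inj_on (\<lambda>i. i(N := (1::int))) (BN N)"
  proof (rule inj_onI)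
    fix i j assume "i \<in> BN N" "j \<in> BN N" "i(N := (1::int)) = j(N := 1)"
    then show "i = j" using vanish by (metis fun_upd_triv fun_upd_upd)
  qed
  have disj: "BN N \<inter> (\<lambda>i. i(N := 1)) ` BN N = {}"
    using vanish by fastforce
  have sign: "sign_of (Suc N) (i(N := 1)) = - sign_of N i" if "i \<in> BN N" for i
  proof -
    \<comment> \<open>\<open>nat\<close> truncates negative numbers to 0; nonnegativity of the
      coordinate sum ensures that the exponent increases by exactly one.\<close>
    have "(\<Sum>k<N. i k) \<ge> 0" using that by (intro sum_nonneg) (force simp: BN_def)
    then show ?thesis by (simp add: sign_of_def nat_add_distrib)
  qed
  have diff: "idx_diff t (i(N := 1)) = idx_diff (t(N := t N - 1)) i" if "i \<in> BN N" for i
    using vanish[OF that] by (auto simp: idx_diff_def)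
  have "Delta (Suc N) Z t \<omega> = (\<Sum>i\<in>BN N. sign_of (Suc N) i *\<^sub>R Z (idx_diff t i) \<omega>)
      + (\<Sum>i\<in>BN N. sign_of (Suc N) (i(N := 1)) *\<^sub>R Z (idx_diff t (i(N := 1))) \<omega>)"
    unfolding Delta_def BN_Suc
    by (subst sum.union_disjoint) (auto simp: finite_BN disj sum.reindex[OF inj])
  also have "(\<Sum>i\<in>BN N. sign_of (Suc N) i *\<^sub>R Z (idx_diff t i) \<omega>) = Delta N Z t \<omega>"
    by (simp add: Delta_def sign_of_def vanish)
  also have "(\<Sum>i\<in>BN N. sign_of (Suc N) (i(N := 1)) *\<^sub>R Z (idx_diff t (i(N := 1))) \<omega>)
      = - Delta N Z (t(N := t N - 1)) \<omega>"
    by (simp add: Delta_def sign diff sum_negf)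
  finally show ?thesis by simp
qed

text \<open>The alternating sum of \<open>z\<close> over the \<open>2 ^ k\<close> points obtained from \<open>t\<close> by replacing some of its
  first \<open>k\<close> coordinates by those of \<open>a\<close>.\<close>
fun corner_sum :: "nat \<Rightarrow> (nat \<Rightarrow> int) \<Rightarrow> ((nat \<Rightarrow> int) \<Rightarrow> 'b::ab_group_add) \<Rightarrow> (nat \<Rightarrow> int) \<Rightarrow> 'b" where
  "corner_sum 0 a z t = z t"
| "corner_sum (Suc k) a z t = corner_sum k a z t - corner_sum k a z (t(k := a k))"

lemma corner_sum_cong: "(\<And>i. i < k \<Longrightarrow> a i = b i) \<Longrightarrow> corner_sum k a z t = corner_sum k b z t"
  by (induction k arbitrary: t) auto

text \<open>Lower bounds are strict so that a telescoping sum ends exactly at the coordinates of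
  \<open>a\<close>. Coordinates from \<open>N\<close> on are frozen at those of \<open>t\<close>
  instead of 0, so a box can be a slice of a box of higher dimension.\<close>

definition lower_box :: "nat \<Rightarrow> (nat \<Rightarrow> int) \<Rightarrow> (nat \<Rightarrow> int) \<Rightarrow> (nat \<Rightarrow> int) set" where
  "lower_box N a t = {j. (\<forall>k<N. a k < j k \<and> j k \<le> t k) \<and> (\<forall>k\<ge>N. j k = t k)}"

lemma lower_box_0: "lower_box 0 a t = {t}"
  by (auto simp: lower_box_def)

lemma lower_box_Suc: "lower_box (Suc N) a t = (\<Union>m\<in>{a N<..t N}. lower_box N a (t(N := m)))"
proof (intro equalityI subsetI)
  fix j assume j: "j \<in> lower_box (Suc N) a t"
  then have "j \<in> lower_box N a (t(N := j N))" "j N \<in> {a N<..t N}"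
    by (auto simp: lower_box_def)
  then show "j \<in> (\<Union>m\<in>{a N<..t N}. lower_box N a (t(N := m)))" by blast
qed (auto simp: lower_box_def less_Suc_eq)

lemma finite_lower_box: "finite (lower_box N a t)"
  by (induction N arbitrary: t) (auto simp: lower_box_0 lower_box_Suc)

lemma lower_box_subset_ZN: "t \<in> ZN N \<Longrightarrow> lower_box N a t \<subseteq> ZN N"
  by (auto simp: lower_box_def ZN_def)

text \<open>The extra -1 turns the inclusive lower bound \<open>- int (Mv k)\<close> into a strict
  one.\<close>

lemma box_eq_lower_box: "t \<in> ZN N \<Longrightarrow> box N t Mv = lower_box N (\<lambda>k. - int (Mv k) - 1) t"
  by (auto simp: box_def lower_box_def ZN_def)

text \<open>Reindexes, in the telescoping argument, the half of the increment that lives one level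
  lower in coordinate \<open>N\<close>.\<close>

lemma lower_box_fun_upd:
  "lower_box N a (t(N := m)) = (\<lambda>j. j(N := m)) ` lower_box N a (t(N := l))"
proof (intro equalityI subsetI)
  fix j assume j: "j \<in> lower_box N a (t(N := m))"
  then have "j = (j(N := l))(N := m)" "j(N := l) \<in> lower_box N a (t(N := l))"
    by (auto simp: lower_box_def)
  then show "j \<in> (\<lambda>j. j(N := m)) ` lower_box N a (t(N := l))" by blast
qed (auto simp: lower_box_def)

lemma sum_telescope_int:
  fixes f :: "int \<Rightarrow> 'b::ab_group_add"
  assumes "a \<le> b"
  shows "(\<Sum>m\<in>{a<..b}. f m - f (m - 1)) = f b - f a"
  using assms
proof (induction b rule: int_ge_induct)
  case (step b)
  then have "{a<..b + 1} = insert (b + 1) {a<..b}" by auto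
  with step show ?case by simp
qed simp

text \<open>Slice along the last coordinate: within a slice the induction hypothesis gives corner
  sums in the first \<open>N\<close> coordinates, and their differences telescope over the heights
  \<open>m\<close>. The bounds \<open>a k \<le> t k\<close> rule out a reversed box, which is empty
  while its corner sum need not be zero.\<close>

lemma sum_Delta_lower_box:
  assumes "\<forall>k<N. a k \<le> t k"
  shows "(\<Sum>j\<in>lower_box N a t. Delta N Z j \<omega>) = corner_sum N a (\<lambda>t. Z t \<omega>) t"
  using assms
proof (induction N arbitrary: t)
  case 0
  show ?case by (simp add: lower_box_0 Delta_0)
next
  case (Suc N)
  let ?c = "corner_sum N a (\<lambda>t. Z t \<omega>)"
  have IH: "(\<Sum>j\<in>lower_box N a (t(N := m)). Delta N Z j \<omega>) = ?c (t(N := m))" for m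
    using Suc.prems by (intro Suc.IH) auto
  have "(\<Sum>j\<in>lower_box (Suc N) a t. Delta (Suc N) Z j \<omega>)
      = (\<Sum>m\<in>{a N<..t N}. \<Sum>j\<in>lower_box N a (t(N := m)). Delta (Suc N) Z j \<omega>)"
    unfolding lower_box_Suc
    by (intro sum.UNION_disjoint) (auto simp: finite_lower_box, auto simp: lower_box_def)
  also have "\<dots> = (\<Sum>m\<in>{a N<..t N}. ?c (t(N := m)) - ?c (t(N := m - 1)))"
  proof (intro sum.cong refl)
    fix m
    have at: "j N = m" if "j \<in> lower_box N a (t(N := m))" for j
      using that by (auto simp: lower_box_def)
    have inj: "inj_on (\<lambda>j. j(N := m - 1)) (lower_box N a (t(N := m)))"
      by (rule inj_onI) (metis at fun_upd_triv fun_upd_upd)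
    have "(\<Sum>j\<in>lower_box N a (t(N := m)). Delta (Suc N) Z j \<omega>)
        = (\<Sum>j\<in>lower_box N a (t(N := m)). Delta N Z j \<omega>)
        - (\<Sum>j\<in>lower_box N a (t(N := m)). Delta N Z (j(N := m - 1)) \<omega>)"
      by (simp add: Delta_Suc sum_subtractf at)
    also have "(\<Sum>j\<in>lower_box N a (t(N := m)). Delta N Z (j(N := m - 1)) \<omega>)
        = (\<Sum>j\<in>lower_box N a (t(N := m - 1)). Delta N Z j \<omega>)"
      unfolding lower_box_fun_upd[of N a t "m - 1" m] by (simp add: sum.reindex[OF inj])
    finally show "(\<Sum>j\<in>lower_box N a (t(N := m)). Delta (Suc N) Z j \<omega>) = ?c (t(N := m)) - ?c (t(N := m - 1))"
      unfolding IH .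
  qed
  also have "\<dots> = ?c (t(N := t N)) - ?c (t(N := a N))"
    using Suc.prems by (intro sum_telescope_int) auto
  finally show ?case by simp
qed

section \<open>Convergence in probability and equality of laws\<close>

text \<open>An arbitrary filter replaces the sequence index: limits run along
  \<open>sequentially\<close> for the truncation bounds and along \<open>at_bot\<close> for integer
  coordinates, and \<open>filterlim\<close> converts one into the other.\<close>

definition null_in_prob :: "'a measure \<Rightarrow> 'i filter \<Rightarrow> ('i \<Rightarrow> 'a \<Rightarrow> 'b::real_normed_vector) \<Rightarrow> bool" where
  "null_in_prob M F Y \<longleftrightarrow> (\<forall>e>0. ((\<lambda>i. measure M {\<omega>\<in>space M. e < norm (Y i \<omega>)}) \<longlongrightarrow> 0) F)"

lemma null_in_probD:
  "null_in_prob M F Y \<Longrightarrow> 0 < e \<Longrightarrow> ((\<lambda>i. measure M {\<omega>\<in>space M. e < norm (Y i \<omega>)}) \<longlongrightarrow> 0) F"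
  by (simp add: null_in_prob_def)

lemma conv_prob_iff_null_in_prob:
  "conv_prob M Y Z \<longleftrightarrow> (\<forall>k. Y k \<in> borel_measurable M) \<and> Z \<in> borel_measurable M \<and>
     null_in_prob M sequentially (\<lambda>k \<omega>. Y k \<omega> - Z \<omega>)"
  by (simp add: conv_prob_def null_in_prob_def)

lemma null_in_prob_filterlim:
  "null_in_prob M F Y \<Longrightarrow> filterlim g F G \<Longrightarrow> null_in_prob M G (\<lambda>i. Y (g i))"
  unfolding null_in_prob_def by (auto intro: filterlim_compose)

lemma null_in_prob_cong_AE:
  assumes "null_in_prob M F Y"
    and "\<And>i. Y i \<in> borel_measurable M" "\<And>i. Y' i \<in> borel_measurable M"
    and "\<forall>\<^sub>F i in F. AE \<omega> in M. Y i \<omega> = Y' i \<omega>"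
  shows "null_in_prob M F Y'"
  unfolding null_in_prob_def
proof (intro allI impI)
  fix e :: real assume "0 < e"
  note [measurable] = assms(2,3)
  have "\<forall>\<^sub>F i in F. measure M {\<omega>\<in>space M. e < norm (Y i \<omega>)} = measure M {\<omega>\<in>space M. e < norm (Y' i \<omega>)}"
    using assms(4)
  proof eventually_elim
    case (elim i)
    show ?case by (rule measure_eq_AE) (use elim in auto)
  qed
  with assms(1) \<open>0 < e\<close> show "((\<lambda>i. measure M {\<omega>\<in>space M. e < norm (Y' i \<omega>)}) \<longlongrightarrow> 0) F"
    unfolding null_in_prob_def by (blast intro: Lim_transform_eventually)
qed

lemma (in finite_measure) null_in_prob_add:
  assumes "null_in_prob M F Y" "null_in_prob M F Z"
    and "\<And>i. Y i \<in> borel_measurable M" "\<And>i. Z i \<in> borel_measurable M"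
  shows "null_in_prob M F (\<lambda>i \<omega>. Y i \<omega> + Z i \<omega>)"
  unfolding null_in_prob_def
proof (intro allI impI)
  fix e :: real assume "0 < e"
  note [measurable] = assms(3,4)
  let ?P = "\<lambda>Y i. measure M {\<omega>\<in>space M. e / 2 < norm (Y i \<omega>)}"
  have lim: "((\<lambda>i. ?P Y i + ?P Z i) \<longlongrightarrow> 0) F"
    using \<open>0 < e\<close> by (intro tendsto_add_zero null_in_probD[OF assms(1)] null_in_probD[OF assms(2)]) auto
  have le: "measure M {\<omega>\<in>space M. e < norm (Y i \<omega> + Z i \<omega>)} \<le> ?P Y i + ?P Z i" for i
  proof -
    have "e / 2 < norm (Y i \<omega>) \<or> e / 2 < norm (Z i \<omega>)" if "e < norm (Y i \<omega> + Z i \<omega>)" for \<omega>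
      using that norm_triangle_ineq[of "Y i \<omega>" "Z i \<omega>"] by linarith
    then have "measure M {\<omega>\<in>space M. e < norm (Y i \<omega> + Z i \<omega>)} \<le>
        measure M ({\<omega>\<in>space M. e / 2 < norm (Y i \<omega>)} \<union> {\<omega>\<in>space M. e / 2 < norm (Z i \<omega>)})"
      by (intro finite_measure_mono) auto
    also have "\<dots> \<le> ?P Y i + ?P Z i"
      by (intro measure_Un_le) auto
    finally show ?thesis .
  qed
  show "((\<lambda>i. measure M {\<omega>\<in>space M. e < norm (Y i \<omega> + Z i \<omega>)}) \<longlongrightarrow> 0) F"
    by (rule tendsto_sandwich[OF always_eventually always_eventually tendsto_const lim])
      (intro allI measure_nonneg le)+
qed

lemma null_in_prob_uminus: "null_in_prob M F Y \<Longrightarrow> null_in_prob M F (\<lambda>i \<omega>. - Y i \<omega>)"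
  by (simp add: null_in_prob_def)

lemma (in finite_measure) null_in_prob_diff:
  fixes Y Z :: "'i \<Rightarrow> 'a \<Rightarrow> 'b::{real_normed_vector, second_countable_topology}"
  assumes "null_in_prob M F Y" "null_in_prob M F Z"
    and "\<And>i. Y i \<in> borel_measurable M" "\<And>i. Z i \<in> borel_measurable M"
  shows "null_in_prob M F (\<lambda>i \<omega>. Y i \<omega> - Z i \<omega>)"
  using null_in_prob_add[OF assms(1) null_in_prob_uminus[OF assms(2)] assms(3) borel_measurable_uminus[OF assms(4)]]
  by simp

lemma (in finite_measure) null_in_prob_matrix_mult:
  fixes A :: "real^'n^'m"
  assumes "null_in_prob M F Y" and [measurable]: "\<And>i. Y i \<in> borel_measurable M"
  shows "null_in_prob M F (\<lambda>i \<omega>. A *v Y i \<omega>)"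
  unfolding null_in_prob_def
proof (intro allI impI)
  fix e :: real assume "0 < e"
  obtain C where C: "C > 0" "norm (A *v x) \<le> norm x * C" for x
    using bounded_linear.pos_bounded[OF matrix_vector_mul_bounded_linear[of A]] by auto
  have lim: "((\<lambda>i. measure M {\<omega>\<in>space M. e / C < norm (Y i \<omega>)}) \<longlongrightarrow> 0) F"
    using assms(1) \<open>0 < e\<close> C unfolding null_in_prob_def by simp
  have le: "measure M {\<omega>\<in>space M. e < norm (A *v Y i \<omega>)} \<le> measure M {\<omega>\<in>space M. e / C < norm (Y i \<omega>)}" for i
  proof (intro finite_measure_mono subsetI)
    fix \<omega> assume "\<omega> \<in> {\<omega>\<in>space M. e < norm (A *v Y i \<omega>)}"
    then show "\<omega> \<in> {\<omega>\<in>space M. e / C < norm (Y i \<omega>)}"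
      using C(1) C(2)[of "Y i \<omega>"] by (simp add: divide_less_eq)
  qed measurable
  show "((\<lambda>i. measure M {\<omega>\<in>space M. e < norm (A *v Y i \<omega>)}) \<longlongrightarrow> 0) F"
    by (rule tendsto_sandwich[OF always_eventually always_eventually tendsto_const lim])
      (intro allI measure_nonneg le)+
qed

text \<open>Yields uniqueness of limits in probability: a constant family has constant tail
  probabilities, which must all be 0, and the countably many levels \<open>1 / real (Suc n)\<close>
  suffice.\<close>

lemma (in finite_measure) null_in_prob_const_imp_AE:
  fixes Y :: "'a \<Rightarrow> 'b::real_normed_vector"
  assumes "null_in_prob M F (\<lambda>_. Y)" "F \<noteq> bot" and [measurable]: "Y \<in> borel_measurable M"
  shows "AE \<omega> in M. Y \<omega> = 0"
proof -
  have "AE \<omega> in M. norm (Y \<omega>) \<le> 1 / real (Suc n)" for n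
  proof -
    have "((\<lambda>i. measure M {\<omega>\<in>space M. 1 / real (Suc n) < norm (Y \<omega>)}) \<longlongrightarrow> 0) F"
      using assms(1) unfolding null_in_prob_def by simp
    then have "measure M {\<omega>\<in>space M. 1 / real (Suc n) < norm (Y \<omega>)} = 0"
      using assms(2) by (simp add: tendsto_const_iff)
    then have "{\<omega>\<in>space M. 1 / real (Suc n) < norm (Y \<omega>)} \<in> null_sets M"
      by (simp add: null_sets_def emeasure_eq_measure)
    then show ?thesis
      by (rule AE_I') (auto simp: not_le)
  qed
  then have "AE \<omega> in M. \<forall>n. norm (Y \<omega>) \<le> 1 / real (Suc n)"
    by (simp add: AE_all_countable)
  then show ?thesis
  proof eventually_elim
    case (elim \<omega>)
    have "norm (Y \<omega>) \<le> 0"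
      by (rule LIMSEQ_le_const[OF lim_inverse_n'[THEN LIMSEQ_Suc]]) (use elim in auto)
    then show ?case by simp
  qed
qed

text \<open>Borel-Cantelli: the tail probabilities are summable, so almost surely
  \<open>norm (Y r \<omega>)\<close> is at most \<open>(1/2) ^ r\<close> from some \<open>r\<close>
  on.\<close>

lemma (in finite_measure) AE_tendsto_0_geometric:
  fixes Y :: "nat \<Rightarrow> 'a \<Rightarrow> 'b::real_normed_vector"
  assumes [measurable]: "\<And>r. Y r \<in> borel_measurable M"
    and small: "\<And>r. measure M {\<omega>\<in>space M. (1/2) ^ r < norm (Y r \<omega>)} \<le> (1/2) ^ r"
  shows "AE \<omega> in M. (\<lambda>r. Y r \<omega>) \<longlonglongrightarrow> 0"
proof -
  let ?A = "\<lambda>r. {\<omega>\<in>space M. (1/2) ^ r < norm (Y r \<omega>)}"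
  have "summable (\<lambda>r. measure M (?A r))"
    by (rule summable_comparison_test'[OF summable_geometric[of "1/2 :: real"]]) (use small in auto)
  then have "AE \<omega> in M. \<forall>\<^sub>F r in sequentially. \<omega> \<in> space M - ?A r"
    by (intro borel_cantelli_AE1) (auto simp: emeasure_eq_measure)
  then show ?thesis
  proof eventually_elim
    case (elim \<omega>)
    show ?case
    proof (rule Lim_null_comparison)
      show "\<forall>\<^sub>F r in sequentially. norm (Y r \<omega>) \<le> (1/2) ^ r"
        using elim by eventually_elim auto
      show "(\<lambda>r. (1/2 :: real) ^ r) \<longlonglongrightarrow> 0"
        by (rule LIMSEQ_realpow_zero) auto
    qed
  qed
qed

section \<open>Laws of finite families and continuous test functions\<close>

lemma closed_indicator_approx:
  fixes A :: "'b::metric_space set"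
  assumes "closed A" "A \<noteq> {}"
  shows "(\<lambda>n. max 0 (1 - real n * infdist x A)) \<longlonglongrightarrow> indicator A x"
proof (cases "x \<in> A")
  case False
  then have pos: "infdist x A > 0"
    using assms by (simp add: infdist_pos_not_in_closed)
  \<comment> \<open>Off a closed set the distance is positive, so the ramp is exactly 0 once
    \<open>n\<close> reaches its reciprocal.\<close>
  obtain m :: nat where m: "1 / infdist x A \<le> real m" using real_arch_simple by blast
  have "\<forall>\<^sub>F n in sequentially. max 0 (1 - real n * infdist x A) = indicator A x"
    using eventually_ge_at_top[of m]
  proof eventually_elim
    case (elim n)
    with m have "1 / infdist x A \<le> real n" by linarith
    then show ?case using False pos by (simp add: field_simps)
  qed
  then show ?thesis by (rule tendsto_eventually)
qed simp

text \<open>Closed boxes are stable under intersection and their indicators are limits of products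
  of continuous functions, which makes this generator fit for comparing laws.\<close>

lemma sets_PiM_borel_closed:
  assumes "finite I"
  shows "sets (PiM I (\<lambda>_. borel :: 'b::topological_space measure)) =
    sigma_sets (I \<rightarrow>\<^sub>E UNIV) {Pi\<^sub>E I A |A. \<forall>i\<in>I. closed (A i :: 'b set)}"
proof -
  let ?P = "{{f \<in> I \<rightarrow>\<^sub>E UNIV. \<forall>i\<in>j. f i \<in> A i} |A j. j \<in> {I} \<and> A \<in> Pi j (\<lambda>_. Collect (closed :: 'b set \<Rightarrow> bool))}"
  have "sets (PiM I (\<lambda>_. borel :: 'b measure)) = sets (sigma (I \<rightarrow>\<^sub>E UNIV) ?P)"
    unfolding borel_eq_closed
    by (rule sets_PiM_sigma) (use assms in \<open>auto intro!: exI[of _ "{UNIV}"]\<close>)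
  also have "?P = {Pi\<^sub>E I A |A. \<forall>i\<in>I. closed (A i)}"
  proof -
    have "{f \<in> I \<rightarrow>\<^sub>E UNIV. \<forall>i\<in>I. f i \<in> A i} = Pi\<^sub>E I A" for A :: "'a \<Rightarrow> 'b set"
      by (auto simp: PiE_def)
    then show ?thesis by (simp add: Pi_iff)
  qed
  finally show ?thesis
    by (subst (asm) sets_measure_of) auto
qed

text \<open>Probability measures agree once they agree on closed boxes. The indicator of a nonempty
  closed box is a bounded limit of products of continuous functions of one coordinate each, so
  dominated convergence carries the equality of integrals over to it.\<close>

lemma (in prob_space) distr_PiM_eqI_continuous:
  fixes X Y :: "'i \<Rightarrow> 'a \<Rightarrow> 'b::metric_space"
  assumes "finite I"
    and X [measurable]: "\<And>i. i \<in> I \<Longrightarrow> X i \<in> borel_measurable M"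
    and Y [measurable]: "\<And>i. i \<in> I \<Longrightarrow> Y i \<in> borel_measurable M"
    and eq: "\<And>f :: 'i \<Rightarrow> 'b \<Rightarrow> real. (\<And>i. continuous_on UNIV (f i)) \<Longrightarrow> (\<And>i x. 0 \<le> f i x \<and> f i x \<le> 1) \<Longrightarrow>
        (\<integral>\<omega>. (\<Prod>i\<in>I. f i (X i \<omega>)) \<partial>M) = (\<integral>\<omega>. (\<Prod>i\<in>I. f i (Y i \<omega>)) \<partial>M)"
  shows "distr M (PiM I (\<lambda>_. borel)) (\<lambda>\<omega>. restrict (\<lambda>i. X i \<omega>) I) =
    distr M (PiM I (\<lambda>_. borel)) (\<lambda>\<omega>. restrict (\<lambda>i. Y i \<omega>) I)"
proof (rule measure_eqI_generator_eq)
  let ?E = "{Pi\<^sub>E I A |A. \<forall>i\<in>I. closed (A i :: 'b set)}"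
  show "Int_stable ?E"
  proof (rule Int_stableI)
    fix a b assume "a \<in> ?E" "b \<in> ?E"
    then obtain A B where "a = Pi\<^sub>E I A" "b = Pi\<^sub>E I B" "\<forall>i\<in>I. closed (A i)" "\<forall>i\<in>I. closed (B i)"
      by auto
    then show "a \<inter> b \<in> ?E"
      by (auto simp: PiE_Int intro!: exI[of _ "\<lambda>i. A i \<inter> B i"])
  qed
  show "?E \<subseteq> Pow (I \<rightarrow>\<^sub>E UNIV)" by (auto simp: PiE_iff)
  show "sets (distr M (PiM I (\<lambda>_. borel)) (\<lambda>\<omega>. restrict (\<lambda>i. X i \<omega>) I)) = sigma_sets (I \<rightarrow>\<^sub>E UNIV) ?E"
    "sets (distr M (PiM I (\<lambda>_. borel)) (\<lambda>\<omega>. restrict (\<lambda>i. Y i \<omega>) I)) = sigma_sets (I \<rightarrow>\<^sub>E UNIV) ?E"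
    by (simp_all add: sets_PiM_borel_closed[OF \<open>finite I\<close>])
  show "range (\<lambda>_::nat. I \<rightarrow>\<^sub>E UNIV) \<subseteq> ?E" "(\<Union>_::nat. I \<rightarrow>\<^sub>E UNIV) = (I \<rightarrow>\<^sub>E UNIV)"
    by (auto intro!: exI[of _ "\<lambda>_. UNIV"])
  have mX: "(\<lambda>\<omega>. restrict (\<lambda>i. X i \<omega>) I) \<in> measurable M (PiM I (\<lambda>_. borel))"
    and mY: "(\<lambda>\<omega>. restrict (\<lambda>i. Y i \<omega>) I) \<in> measurable M (PiM I (\<lambda>_. borel))"
    by measurable
  show "emeasure (distr M (PiM I (\<lambda>_. borel)) (\<lambda>\<omega>. restrict (\<lambda>i. X i \<omega>) I)) (I \<rightarrow>\<^sub>E UNIV) \<noteq> \<infinity>"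
  proof -
    interpret D: prob_space "distr M (PiM I (\<lambda>_. borel)) (\<lambda>\<omega>. restrict (\<lambda>i. X i \<omega>) I)"
      using mX by (rule prob_space_distr)
    show ?thesis by (simp add: D.emeasure_eq_measure)
  qed
  fix a assume "a \<in> ?E"
  then obtain A where a: "a = Pi\<^sub>E I A" and A: "\<forall>i\<in>I. closed (A i)" by auto
  have meas: "a \<in> sets (PiM I (\<lambda>_. borel))"
    unfolding a using A \<open>finite I\<close> by (intro sets_PiM_I_finite) auto
  show "emeasure (distr M (PiM I (\<lambda>_. borel)) (\<lambda>\<omega>. restrict (\<lambda>i. X i \<omega>) I)) a =
    emeasure (distr M (PiM I (\<lambda>_. borel)) (\<lambda>\<omega>. restrict (\<lambda>i. Y i \<omega>) I)) a"
  \<comment> \<open>An empty factor is treated apart: \<open>infdist\<close> to the empty set is 0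
    by convention, so the ramps would be constantly 1 instead of tending to 0.\<close>
  proof (cases "\<exists>i\<in>I. A i = {}")
    case True
    then have "a = {}" unfolding a by (simp add: PiE_eq_empty_iff)
    then show ?thesis by simp
  next
    case False
    \<comment> \<open>\<open>eq\<close> asks for continuity and bounds at every index, so
      \<open>f\<close> gets the default 0 outside \<open>I\<close>.\<close>
    define f where "f n i x = (if i \<in> I then max 0 (1 - real n * infdist x (A i)) else 0)" for n i x
    have cont: "continuous_on UNIV (f n i)" for n i
      unfolding f_def by (cases "i \<in> I") (auto intro!: continuous_intros)
    have bound: "0 \<le> f n i x \<and> f n i x \<le> 1" for n i x
      unfolding f_def by (auto simp: infdist_nonneg)
    have lim: "(\<lambda>n. \<integral>\<omega>. (\<Prod>i\<in>I. f n i (W i \<omega>)) \<partial>M) \<longlonglongrightarrow>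
        measure (distr M (PiM I (\<lambda>_. borel)) (\<lambda>\<omega>. restrict (\<lambda>i. W i \<omega>) I)) a"
      if W [measurable]: "\<And>i. i \<in> I \<Longrightarrow> W i \<in> borel_measurable M" for W
    proof -
      have mf [measurable]: "f n i \<in> borel_measurable borel" for n i
        using cont by (rule borel_measurable_continuous_onI)
      have mW: "(\<lambda>\<omega>. restrict (\<lambda>i. W i \<omega>) I) \<in> measurable M (PiM I (\<lambda>_. borel))"
        by measurable
      have "(\<lambda>n. \<integral>\<omega>. (\<Prod>i\<in>I. f n i (W i \<omega>)) \<partial>M) \<longlonglongrightarrow> (\<integral>\<omega>. indicator a (restrict (\<lambda>i. W i \<omega>) I) \<partial>M)"
      proof (rule integral_dominated_convergence[where w = "\<lambda>_. 1"])
        show "(\<lambda>\<omega>. indicator a (restrict (\<lambda>i. W i \<omega>) I)) \<in> borel_measurable M"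
          using borel_measurable_indicator[OF meas] mW by (rule measurable_compose[rotated])
        show "(\<lambda>\<omega>. \<Prod>i\<in>I. f n i (W i \<omega>)) \<in> borel_measurable M" for n
          by measurable
        show "AE \<omega> in M. norm (\<Prod>i\<in>I. f n i (W i \<omega>)) \<le> 1" for n
          using bound by (auto simp: abs_prod intro!: AE_I2 prod_le_1)
        have "(\<lambda>n. \<Prod>i\<in>I. f n i (W i \<omega>)) \<longlonglongrightarrow> indicator a (restrict (\<lambda>i. W i \<omega>) I)" for \<omega>
        proof -
          have "(\<lambda>n. \<Prod>i\<in>I. f n i (W i \<omega>)) \<longlonglongrightarrow> (\<Prod>i\<in>I. indicator (A i) (W i \<omega>))"
            unfolding f_def using A False
            by (intro tendsto_prod) (auto intro!: closed_indicator_approx)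
          also have "(\<Prod>i\<in>I. indicator (A i) (W i \<omega>)) = (indicator a (restrict (\<lambda>i. W i \<omega>) I) :: real)"
            using \<open>finite I\<close> by (auto simp: a indicator_def PiE_iff prod_zero_iff)
          finally show ?thesis .
        qed
        then show "AE \<omega> in M. (\<lambda>n. \<Prod>i\<in>I. f n i (W i \<omega>)) \<longlonglongrightarrow> indicator a (restrict (\<lambda>i. W i \<omega>) I)"
          by simp
      qed simp
      also have "(\<integral>\<omega>. indicator a (restrict (\<lambda>i. W i \<omega>) I) \<partial>M) =
          (\<integral>x. indicator a x \<partial>distr M (PiM I (\<lambda>_. borel)) (\<lambda>\<omega>. restrict (\<lambda>i. W i \<omega>) I) :: real)"
        using mW borel_measurable_indicator[OF meas] by (rule integral_distr[symmetric])
      also have "\<dots> = measure (distr M (PiM I (\<lambda>_. borel)) (\<lambda>\<omega>. restrict (\<lambda>i. W i \<omega>) I)) a"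
        using meas sets.sets_into_space[OF meas] by (simp add: Int_absorb2)
      finally show ?thesis .
    qed
    have "(\<integral>\<omega>. (\<Prod>i\<in>I. f n i (X i \<omega>)) \<partial>M) = (\<integral>\<omega>. (\<Prod>i\<in>I. f n i (Y i \<omega>)) \<partial>M)" for n
      by (rule eq) (rule cont, rule bound)
    then have "measure (distr M (PiM I (\<lambda>_. borel)) (\<lambda>\<omega>. restrict (\<lambda>i. X i \<omega>) I)) a =
        measure (distr M (PiM I (\<lambda>_. borel)) (\<lambda>\<omega>. restrict (\<lambda>i. Y i \<omega>) I)) a"
      using lim[OF X] lim[OF Y] by (intro LIMSEQ_unique[OF lim[OF X]]) simp_all
    moreover have "finite_measure (distr M (PiM I (\<lambda>_. borel)) (\<lambda>\<omega>. restrict (\<lambda>i. X i \<omega>) I))"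
      "finite_measure (distr M (PiM I (\<lambda>_. borel)) (\<lambda>\<omega>. restrict (\<lambda>i. Y i \<omega>) I))"
      using mX mY by (auto intro: finite_measure_distr)
    ultimately show ?thesis
      by (simp add: finite_measure.emeasure_eq_measure)
  qed
qed

section \<open>Fields vanishing along each coordinate\<close>

lemma borel_measurable_matrix_vector_mult [measurable (raw)]:
  fixes A :: "real^'n^'m"
  assumes "f \<in> borel_measurable M"
  shows "(\<lambda>\<omega>. A *v f \<omega>) \<in> borel_measurable M"
  using assms
  by (rule measurable_compose)
    (intro borel_measurable_continuous_onI linear_continuous_on matrix_vector_mul_bounded_linear)

text \<open>The form in which hypothesis (i) is used for the weighted field. Only one coordinate
  moves at a time, and \<open>at_bot\<close> on the integers makes the condition insensitive to
  shifts of the index.\<close>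

definition vanishing_field :: "'a measure \<Rightarrow> nat \<Rightarrow> ((nat \<Rightarrow> int) \<Rightarrow> 'a \<Rightarrow> real^'n) \<Rightarrow> bool" where
  "vanishing_field M N Z \<longleftrightarrow> (\<forall>t\<in>ZN N. Z t \<in> borel_measurable M) \<and>
     (\<forall>j<N. \<forall>t\<in>ZN N. null_in_prob M at_bot (\<lambda>m::int. Z (t(j := m))))"

lemma vanishing_field_shift:
  assumes "vanishing_field M N Z" "s \<in> ZN N"
  shows "vanishing_field M N (\<lambda>t. Z (idx_add t s))"
proof -
  have "null_in_prob M at_bot (\<lambda>m. Z (idx_add (t(j := m)) s))" if "j < N" "t \<in> ZN N" for j t
  proof -
    have "null_in_prob M at_bot (\<lambda>m. Z ((idx_add t s)(j := m)))"
      using assms that by (auto simp: vanishing_field_def idx_add_in_ZN)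
    moreover have "filterlim (\<lambda>m::int. m + s j) at_bot at_bot"
      unfolding filterlim_at_bot
    proof
      fix b
      show "\<forall>\<^sub>F m in at_bot. m + s j \<le> b"
        using eventually_le_at_bot[of "b - s j"] by eventually_elim simp
    qed
    ultimately have "null_in_prob M at_bot (\<lambda>m. Z ((idx_add t s)(j := m + s j)))"
      by (rule null_in_prob_filterlim)
    moreover have "(idx_add t s)(j := m + s j) = idx_add (t(j := m)) s" for m
      by (auto simp: idx_add_def)
    ultimately show ?thesis by simp
  qed
  with assms show ?thesis
    by (auto simp: vanishing_field_def idx_add_in_ZN)
qed

lemma corner_sum_measurable:
  assumes "\<forall>t\<in>ZN N. Z t \<in> borel_measurable M" "k \<le> N" "t \<in> ZN N"
  shows "(\<lambda>\<omega>. corner_sum k a (\<lambda>t. Z t \<omega> :: real^'n) t) \<in> borel_measurable M"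
  using assms(2,3)
proof (induction k arbitrary: t)
  case (Suc k)
  then show ?case
    by (auto intro!: borel_measurable_diff simp: ZN_fun_upd)
qed (use assms(1) in simp)

text \<open>Only coordinates below \<open>k\<close> are replaced, and \<open>k \<le> j\<close>, so
  each of the finitely many summands still has \<open>m\<close> in coordinate \<open>j\<close> and
  vanishes in the limit.\<close>

lemma (in finite_measure) corner_sum_null_in_prob:
  assumes Z: "vanishing_field M N Z" and "k \<le> j" "j < N" "t \<in> ZN N"
  shows "null_in_prob M at_bot (\<lambda>m \<omega>. corner_sum k a (\<lambda>t. Z t \<omega>) (t(j := m)))"
  using assms(2,4)
proof (induction k arbitrary: t)
  case 0
  with Z \<open>j < N\<close> show ?case
    unfolding vanishing_field_def corner_sum.simps by blast
next
  case (Suc k)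
  have meas: "\<forall>t\<in>ZN N. Z t \<in> borel_measurable M"
    using Z by (simp add: vanishing_field_def)
  have "k < N" using Suc \<open>j < N\<close> by simp
  have "null_in_prob M at_bot (\<lambda>m \<omega>. corner_sum k a (\<lambda>t. Z t \<omega>) (t(j := m))
      - corner_sum k a (\<lambda>t. Z t \<omega>) ((t(k := a k))(j := m)))"
    using Suc \<open>k < N\<close> \<open>j < N\<close>
    by (intro null_in_prob_diff Suc.IH corner_sum_measurable[OF meas] ZN_fun_upd) auto
  moreover have "(t(k := a k))(j := m) = (t(j := m))(k := a k)" for m
    using Suc.prems by (intro fun_upd_twist) auto
  ultimately show ?case by (simp only: corner_sum.simps)
qed

text \<open>The corner coordinates are chosen one after the other, each depending on the previous ones:
  the fields only vanish along single coordinates, not as all coordinates tend to minus infinity.\<close>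
lemma (in finite_measure) corner_sum_approx:
  fixes Z :: "'p \<Rightarrow> (nat \<Rightarrow> int) \<Rightarrow> 'a \<Rightarrow> real^'n"
  assumes "finite P" and Z: "\<And>p. p \<in> P \<Longrightarrow> vanishing_field M N (Z p)"
    and t: "\<And>p. p \<in> P \<Longrightarrow> t p \<in> ZN N" and "0 < e" "k \<le> N"
  shows "\<exists>a. (\<forall>i<k. a i \<le> b) \<and> (\<forall>p\<in>P.
    measure M {\<omega>\<in>space M. e < norm (corner_sum k a (\<lambda>u. Z p u \<omega>) (t p) - Z p (t p) \<omega>)} < e)"
  using \<open>0 < e\<close> \<open>k \<le> N\<close>
proof (induction k arbitrary: e)
  case 0
  then show ?case by simp
next
  case (Suc k)
  then obtain a where a: "\<forall>i<k. a i \<le> b" "\<forall>p\<in>P.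
      measure M {\<omega>\<in>space M. e / 2 < norm (corner_sum k a (\<lambda>u. Z p u \<omega>) (t p) - Z p (t p) \<omega>)} < e / 2"
    using Suc.IH[of "e / 2"] by auto
  have meas: "\<forall>t\<in>ZN N. Z p t \<in> borel_measurable M" if "p \<in> P" for p
    using Z[OF that] by (simp add: vanishing_field_def)
  have "\<forall>\<^sub>F m in at_bot. measure M {\<omega>\<in>space M. e / 2 < norm (corner_sum k a (\<lambda>u. Z p u \<omega>) ((t p)(k := m)))} < e / 2"
    if "p \<in> P" for p
  proof -
    have "null_in_prob M at_bot (\<lambda>m \<omega>. corner_sum k a (\<lambda>u. Z p u \<omega>) ((t p)(k := m)))"
      using Suc.prems by (intro corner_sum_null_in_prob[where N = N] Z t that) auto
    from null_in_probD[OF this, of "e / 2"] show ?thesis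
      by (rule order_tendstoD(2)) (use Suc.prems in auto)
  qed
  \<comment> \<open>\<open>a\<close> is fixed here, so each corner error vanishes as the new
    coordinate \<open>m\<close> decreases. Since \<open>P\<close> is finite, one \<open>m\<close>
    serves all \<open>p\<close> and can be taken at most \<open>b\<close>.\<close>
  then have "\<forall>\<^sub>F m in at_bot. m \<le> b \<and> (\<forall>p\<in>P.
      measure M {\<omega>\<in>space M. e / 2 < norm (corner_sum k a (\<lambda>u. Z p u \<omega>) ((t p)(k := m)))} < e / 2)"
    using \<open>finite P\<close> by (intro eventually_conj eventually_le_at_bot) (auto simp: eventually_ball_finite_distrib)
  from eventually_happens'[OF trivial_limit_at_bot_linorder this]
  obtain m where m: "m \<le> b" "\<forall>p\<in>P.
      measure M {\<omega>\<in>space M. e / 2 < norm (corner_sum k a (\<lambda>u. Z p u \<omega>) ((t p)(k := m)))} < e / 2"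
    by (elim exE conjE)
  show ?case
  proof (intro exI[of _ "a(k := m)"] conjI ballI)
    show "\<forall>i<Suc k. (a(k := m)) i \<le> b"
      using a(1) m(1) by (auto simp: less_Suc_eq)
    fix p assume p: "p \<in> P"
    define C where "C u \<omega> = corner_sum k a (\<lambda>u. Z p u \<omega>) u" for u \<omega>
    have [measurable]: "C u \<in> borel_measurable M" "Z p u \<in> borel_measurable M" if "u \<in> ZN N" for u
      using Suc.prems that meas[OF p] corner_sum_measurable[OF meas[OF p]] by (auto simp: C_def[abs_def])
    have [measurable, simp]: "t p \<in> ZN N" "(t p)(k := m) \<in> ZN N"
      using Suc.prems t[OF p] by (auto intro: ZN_fun_upd)
    let ?S = "{\<omega>\<in>space M. e / 2 < norm (C (t p) \<omega> - Z p (t p) \<omega>)}"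
    let ?R = "{\<omega>\<in>space M. e / 2 < norm (C ((t p)(k := m)) \<omega>)}"
    \<comment> \<open>The corner sum of order \<open>k\<close> ignores coordinate \<open>k\<close>
      of \<open>a\<close>, so the earlier choices keep their error bound.\<close>
    have corner: "corner_sum (Suc k) (a(k := m)) (\<lambda>u. Z p u \<omega>) (t p) = C (t p) \<omega> - C ((t p)(k := m)) \<omega>" for \<omega>
      by (simp add: C_def corner_sum_cong[of k "a(k := m)" a])
    have "{\<omega>\<in>space M. e < norm (corner_sum (Suc k) (a(k := m)) (\<lambda>u. Z p u \<omega>) (t p) - Z p (t p) \<omega>)} \<subseteq> ?S \<union> ?R"
    proof
      fix \<omega> assume "\<omega> \<in> {\<omega>\<in>space M. e < norm (corner_sum (Suc k) (a(k := m)) (\<lambda>u. Z p u \<omega>) (t p) - Z p (t p) \<omega>)}"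
      then have "\<omega> \<in> space M" "e < norm ((C (t p) \<omega> - Z p (t p) \<omega>) - C ((t p)(k := m)) \<omega>)"
        unfolding corner by (auto simp: algebra_simps)
      with norm_triangle_ineq4[of "C (t p) \<omega> - Z p (t p) \<omega>" "C ((t p)(k := m)) \<omega>"]
      show "\<omega> \<in> ?S \<union> ?R" by auto
    qed
    then have "measure M {\<omega>\<in>space M. e < norm (corner_sum (Suc k) (a(k := m)) (\<lambda>u. Z p u \<omega>) (t p) - Z p (t p) \<omega>)}
        \<le> measure M (?S \<union> ?R)"
      by (intro finite_measure_mono) auto
    also have "\<dots> \<le> measure M ?S + measure M ?R"
      by (intro measure_Un_le) auto
    also have "\<dots> < e / 2 + e / 2"
      using a(2) m(2) p unfolding C_def by (intro add_strict_mono) auto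
    finally show "measure M {\<omega>\<in>space M. e < norm (corner_sum (Suc k) (a(k := m)) (\<lambda>u. Z p u \<omega>) (t p) - Z p (t p) \<omega>)} < e"
      by simp
  qed
qed

section \<open>The recursion\<close>

locale recursive_field = prob_space M
  for M :: "'a measure" and N :: nat and Th :: "nat \<Rightarrow> real^'n^'n"
    and X G :: "(nat \<Rightarrow> int) \<Rightarrow> 'a \<Rightarrow> real^'n" +
  assumes commuting: "\<forall>i<N. \<forall>j<N. Th i ** Th j = Th j ** Th i"
    and X_measurable: "\<And>t. t \<in> ZN N \<Longrightarrow> X t \<in> borel_measurable M"
    and G_measurable: "\<And>t. t \<in> ZN N \<Longrightarrow> G t \<in> borel_measurable M"
    and X_vanishing: "\<And>j t. j < N \<Longrightarrow> t \<in> ZN N \<Longrightarrow>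
           conv_prob M (\<lambda>k \<omega>. mexp (real_of_int (- int k) *\<^sub>R Th j) *v X (t(j := - int k)) \<omega>) (\<lambda>_. 0)"
    and recursion: "\<And>t. t \<in> ZN N \<Longrightarrow> AE \<omega> in M. X t \<omega> =
           (\<Sum>i\<in>BN N - {\<lambda>_. 0}. (- sign_of N i) *\<^sub>R (mexp (- tTheta N Th i) *v X (idx_diff t i) \<omega>))
           + Delta N G t \<omega>"
begin

definition Z :: "(nat \<Rightarrow> int) \<Rightarrow> 'a \<Rightarrow> real^'n" where
  "Z t \<omega> = mexp (tTheta N Th t) *v X t \<omega>"

lemma X_eq_Z: "X t \<omega> = mexp (- tTheta N Th t) *v Z t \<omega>"
  by (simp add: Z_def matrix_vector_mul_assoc mexp_uminus_mult)

lemma Delta_G_measurable [measurable]: "t \<in> ZN N \<Longrightarrow> Delta N G t \<in> borel_measurable M"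
  unfolding Delta_def[abs_def]
  by (intro borel_measurable_sum borel_measurable_scaleR borel_measurable_const G_measurable idx_diff_in_ZN)

text \<open>Commutativity splits the weight at \<open>idx_diff t i\<close> into the weight at
  \<open>t\<close> times the coefficient of the recursion. The index 0 contributes
  \<open>X t\<close>, and by the recursion the other terms leave only the increment of
  \<open>G\<close>.\<close>

lemma AE_Delta_Z:
  assumes t: "t \<in> ZN N"
  shows "AE \<omega> in M. Delta N Z t \<omega> = mexp (tTheta N Th t) *v Delta N G t \<omega>"
  using recursion[OF t]
proof eventually_elim
  case (elim \<omega>)
  let ?x = "\<lambda>i. mexp (- tTheta N Th i) *v X (idx_diff t i) \<omega>"
  have "Delta N Z t \<omega> = (\<Sum>i\<in>BN N. sign_of N i *\<^sub>R (mexp (tTheta N Th t) *v ?x i))"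
    by (simp add: Delta_def Z_def mexp_tTheta_diff(1)[OF commuting] matrix_vector_mul_assoc)
  also have "\<dots> = mexp (tTheta N Th t) *v (\<Sum>i\<in>BN N. sign_of N i *\<^sub>R ?x i)"
    by (simp add: matrix_vector_mult_sum_right matrix_vector_mult_scaleR)
  also have "(\<Sum>i\<in>BN N. sign_of N i *\<^sub>R ?x i) = X t \<omega> + (\<Sum>i\<in>BN N - {\<lambda>_. 0}. sign_of N i *\<^sub>R ?x i)"
    by (simp add: sum.remove[OF finite_BN zero_in_BN] sign_of_def idx_diff_def)
  also have "\<dots> = Delta N G t \<omega>"
    by (subst elim) (simp add: sum_negf)
  finally show ?case .
qed

lemma vanishing_Z: "vanishing_field M N Z"
  unfolding vanishing_field_def
proof (intro conjI ballI allI impI)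
  fix t assume "t \<in> ZN N"
  then show "Z t \<in> borel_measurable M"
    unfolding Z_def[abs_def] by (intro borel_measurable_matrix_vector_mult X_measurable)
next
  fix j t assume j: "j < N" and t: "t \<in> ZN N"
  let ?Y = "\<lambda>m \<omega>. mexp (real_of_int m *\<^sub>R Th j) *v X (t(j := m)) \<omega>"
  let ?A = "mexp (tTheta N Th (t(j := 0)))"
  have meas: "?Y m \<in> borel_measurable M" for m
    using j t by (intro borel_measurable_matrix_vector_mult X_measurable ZN_fun_upd)
  \<comment> \<open>Along coordinate \<open>j\<close> the weight is a fixed matrix times the
    one-coordinate weight of hypothesis (i).\<close>
  have Z_eq: "Z (t(j := m)) = (\<lambda>\<omega>. ?A *v ?Y m \<omega>)" for m
  proof -
    have "t(j := m) = idx_add (t(j := 0)) ((\<lambda>_. 0)(j := m))"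
      by (auto simp: idx_add_def)
    then have "mexp (tTheta N Th (t(j := m))) = ?A ** mexp (real_of_int m *\<^sub>R Th j)"
      using mexp_tTheta_add[OF commuting, of "t(j := 0)" "(\<lambda>_. 0)(j := m)"] j
      by (simp only: tTheta_single)
    then show ?thesis by (simp add: Z_def[abs_def] matrix_vector_mul_assoc)
  qed
  have "null_in_prob M sequentially (\<lambda>k. ?Y (- int k))"
    using X_vanishing[OF j t] unfolding conv_prob_iff_null_in_prob by simp
  \<comment> \<open>Hypothesis (i) runs along \<open>- int k\<close>. Substituting
    \<open>nat (- m)\<close> for \<open>k\<close> turns it into a limit over integers
    \<open>m\<close>, since \<open>- int (nat (- m))\<close> equals \<open>m\<close> for
    \<open>m \<le> 0\<close>.\<close>
  moreover have "filterlim (\<lambda>m::int. nat (- m)) sequentially at_bot"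
    unfolding filterlim_at_top
  proof
    fix n
    show "\<forall>\<^sub>F m in at_bot. n \<le> nat (- m)"
      using eventually_le_at_bot[of "- int n"] by eventually_elim linarith
  qed
  ultimately have "null_in_prob M at_bot (\<lambda>m. ?Y (- int (nat (- m))))"
    by (rule null_in_prob_filterlim)
  then have "null_in_prob M at_bot ?Y"
  proof (rule null_in_prob_cong_AE[OF _ meas meas])
    show "\<forall>\<^sub>F m in at_bot. AE \<omega> in M. ?Y (- int (nat (- m))) \<omega> = ?Y m \<omega>"
      using eventually_le_at_bot[of 0] by eventually_elim simp
  qed
  then show "null_in_prob M at_bot (\<lambda>m. Z (t(j := m)))"
    unfolding Z_eq using meas by (rule null_in_prob_matrix_mult)
qed

lemma Z_measurable: "\<forall>t\<in>ZN N. Z t \<in> borel_measurable M"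
  using vanishing_Z by (simp add: vanishing_field_def)

text \<open>The shift \<open>s\<close> is carried along so that the original and the shifted field
  are covered alike. A box is finite, so the almost sure identities at its points hold
  simultaneously.\<close>

lemma AE_corner_sum_Z:
  assumes t: "t \<in> ZN N" and s: "s \<in> ZN N" and a: "\<forall>k<N. a k \<le> t k"
  shows "AE \<omega> in M. corner_sum N a (\<lambda>u. Z (idx_add u s) \<omega>) t =
    (\<Sum>j\<in>lower_box N a t. mexp (tTheta N Th (idx_add j s)) *v Delta N G (idx_add j s) \<omega>)"
proof -
  have "AE \<omega> in M. \<forall>j\<in>lower_box N a t. Delta N Z (idx_add j s) \<omega> =
      mexp (tTheta N Th (idx_add j s)) *v Delta N G (idx_add j s) \<omega>"
    using lower_box_subset_ZN[OF t] s
    by (intro AE_finite_allI finite_lower_box AE_Delta_Z idx_add_in_ZN) auto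
  then show ?thesis
  proof eventually_elim
    case (elim \<omega>)
    have "idx_diff (idx_add j s) i = idx_add (idx_diff j i) s" for j i
      by (auto simp: idx_diff_def idx_add_def)
    then have "Delta N (\<lambda>u. Z (idx_add u s)) j \<omega> = Delta N Z (idx_add j s) \<omega>" for j
      by (simp add: Delta_def)
    then show ?case
      using elim sum_Delta_lower_box[OF a, of "\<lambda>u. Z (idx_add u s)" \<omega>] by simp
  qed
qed

text \<open>Downward induction from the finite sums at \<open>k = N\<close> to the full limit at
  \<open>k = 0\<close>: the intermediate limit \<open>L k\<close> is almost surely the corner sum
  over the first \<open>k\<close> coordinates, because sending coordinate \<open>k\<close> to minus
  infinity removes the corners that use it.\<close>

lemma AE_Minv_eq:
  assumes t: "t \<in> ZN N" and "Minv_at M N Th G t Y"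
  shows "AE \<omega> in M. Z t \<omega> = Y \<omega>"
proof -
  define a where "a Mv k = - int (Mv k) - 1" for Mv :: "nat \<Rightarrow> nat" and k
  obtain L where
    LN: "\<And>Mv. L N Mv = (\<lambda>\<omega>. \<Sum>j\<in>box N t Mv. mexp (tTheta N Th j) *v Delta N G j \<omega>)" and
    L: "\<And>k Mv. k < N \<Longrightarrow> conv_prob M (\<lambda>m. L (Suc k) (Mv(k := m))) (L k Mv)" and
    Y: "Y = L 0 (\<lambda>_. 0)"
    using assms(2) unfolding Minv_at_def iter_lim_prob_def by blast
  \<comment> \<open>Only coordinates below \<open>k\<close> are still truncated, so only there must
    the truncation lie below \<open>t\<close>; at \<open>k = 0\<close> the condition is
    empty.\<close>
  have "\<forall>Mv. (\<forall>i<k. a Mv i \<le> t i) \<longrightarrow> (AE \<omega> in M. L k Mv \<omega> = corner_sum k (a Mv) (\<lambda>u. Z u \<omega>) t)"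
    if "k \<le> N" for k
    using that
  proof (induction k rule: inc_induct)
    case base
    show ?case
    proof (intro allI impI)
      fix Mv assume "\<forall>i<N. a Mv i \<le> t i"
      moreover have "(\<lambda>_. 0) \<in> ZN N" by (simp add: ZN_def)
      moreover have "box N t Mv = lower_box N (a Mv) t"
        using t by (simp add: box_eq_lower_box a_def[abs_def])
      ultimately show "AE \<omega> in M. L N Mv \<omega> = corner_sum N (a Mv) (\<lambda>u. Z u \<omega>) t"
        using AE_corner_sum_Z[OF t, of "\<lambda>_. 0" "a Mv"] unfolding LN by (simp add: eq_commute)
    qed
  next
    case (step k)
    show ?case
    proof (intro allI impI)
      fix Mv assume Mv: "\<forall>i<k. a Mv i \<le> t i"
      define D where "D u \<omega> = corner_sum k (a Mv) (\<lambda>u. Z u \<omega>) u" for u \<omega>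
      have D_measurable: "D u \<in> borel_measurable M" if "u \<in> ZN N" for u
        unfolding D_def[abs_def] using step that by (intro corner_sum_measurable[OF Z_measurable]) auto
      note conv = L[OF \<open>k < N\<close>, of Mv, unfolded conv_prob_iff_null_in_prob]
      have "filterlim (\<lambda>m. - int m - 1) at_bot sequentially"
        unfolding filterlim_at_bot
      proof
        fix b :: int
        show "\<forall>\<^sub>F m in sequentially. - int m - 1 \<le> b"
          using eventually_ge_at_top[of "nat (- b)"] by eventually_elim linarith
      qed
      from null_in_prob_filterlim[OF corner_sum_null_in_prob[OF vanishing_Z order_refl \<open>k < N\<close> t] this]
      have R: "null_in_prob M sequentially (\<lambda>m. D (t(k := - int m - 1)))"
        unfolding D_def[abs_def] .
      have R_measurable: "D (t(k := - int m - 1)) \<in> borel_measurable M" for m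
        using \<open>k < N\<close> t by (intro D_measurable ZN_fun_upd)
      have diff_measurable: "(\<lambda>\<omega>. L (Suc k) (Mv(k := m)) \<omega> - L k Mv \<omega>) \<in> borel_measurable M" for m
        using conv by (intro borel_measurable_diff) auto
      \<comment> \<open>By the induction hypothesis this sum is almost surely
        \<open>D t \<omega> - L k Mv \<omega>\<close> for large \<open>m\<close>. That does not
        depend on \<open>m\<close>, so being null in probability it is 0 almost surely.\<close>
      have "null_in_prob M sequentially
          (\<lambda>m \<omega>. (L (Suc k) (Mv(k := m)) \<omega> - L k Mv \<omega>) + D (t(k := - int m - 1)) \<omega>)"
        using conv R diff_measurable R_measurable by (intro null_in_prob_add) auto
      then have "null_in_prob M sequentially (\<lambda>m \<omega>. D t \<omega> - L k Mv \<omega>)"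
      proof (rule null_in_prob_cong_AE)
        show "(\<lambda>\<omega>. (L (Suc k) (Mv(k := m)) \<omega> - L k Mv \<omega>) + D (t(k := - int m - 1)) \<omega>) \<in> borel_measurable M" for m
          by (intro borel_measurable_add diff_measurable R_measurable)
        show "(\<lambda>\<omega>. D t \<omega> - L k Mv \<omega>) \<in> borel_measurable M" for m :: nat
          using conv t by (intro borel_measurable_diff D_measurable) auto
        show "\<forall>\<^sub>F m in sequentially. AE \<omega> in M.
            (L (Suc k) (Mv(k := m)) \<omega> - L k Mv \<omega>) + D (t(k := - int m - 1)) \<omega> = D t \<omega> - L k Mv \<omega>"
          \<comment> \<open>This bound on \<open>m\<close> gives
            \<open>- int m - 1 \<le> t k\<close>, the condition of the induction hypothesis in
            coordinate \<open>k\<close>.\<close>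
          using eventually_ge_at_top[of "nat (- t k)"]
        proof eventually_elim
          case (elim m)
          then have "\<forall>i<Suc k. a (Mv(k := m)) i \<le> t i"
            using Mv by (auto simp: less_Suc_eq a_def)
          then have "AE \<omega> in M. L (Suc k) (Mv(k := m)) \<omega> =
              corner_sum (Suc k) (a (Mv(k := m))) (\<lambda>u. Z u \<omega>) t"
            using step.IH by blast
          moreover have "corner_sum (Suc k) (a (Mv(k := m))) (\<lambda>u. Z u \<omega>) t =
              D t \<omega> - D (t(k := - int m - 1)) \<omega>" for \<omega>
          proof -
            have "corner_sum k (a (Mv(k := m))) (\<lambda>u. Z u \<omega>) u = D u \<omega>" for u
              unfolding D_def by (rule corner_sum_cong) (simp add: a_def)
            then show ?thesis by (simp add: a_def)
          qed
          ultimately have "AE \<omega> in M. L (Suc k) (Mv(k := m)) \<omega> = D t \<omega> - D (t(k := - int m - 1)) \<omega>"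
            by (simp only:)
          then show ?case by eventually_elim simp
        qed
      qed
      then have "AE \<omega> in M. D t \<omega> - L k Mv \<omega> = 0"
        using conv t by (intro null_in_prob_const_imp_AE borel_measurable_diff D_measurable) auto
      then show "AE \<omega> in M. L k Mv \<omega> = corner_sum k (a Mv) (\<lambda>u. Z u \<omega>) t"
        by eventually_elim (simp add: D_def)
    qed
  qed
  from this[of 0] show ?thesis by (simp add: Y eq_commute)
qed

lemma stationary_X:
  assumes "stat_incr M N G"
  shows "stationary M N X"
  unfolding stationary_def eq_law_def
proof (intro ballI allI impI, elim conjE)
  fix s and T :: "(nat \<Rightarrow> int) set"
  assume s: "s \<in> ZN N" and T: "finite T" "T \<subseteq> ZN N"
  define z where "z = (\<lambda>_::nat. 0::int)"
  have z: "z \<in> ZN N" by (simp add: z_def ZN_def)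
  have add_z [simp]: "idx_add t z = t" for t by (simp add: z_def)
  \<comment> \<open>A lower bound for all coordinates of points of \<open>T\<close>: corners at most
    \<open>b\<close> satisfy the box condition for every \<open>t\<close> in \<open>T\<close>.
    Inserting 0 keeps the set nonempty when \<open>T\<close> is empty or \<open>N\<close> is
    0.\<close>
  define b where "b = Min (insert 0 ((\<lambda>(t, k). t k) ` (T \<times> {..<N})))"
  have b: "b \<le> t k" if "t \<in> T" "k < N" for t k
    unfolding b_def using T that by (intro Min_le) force+
  \<comment> \<open>For each \<open>r\<close> one corner serves all of \<open>T\<close> and both
    shifts, \<open>z\<close> for the field itself and \<open>s\<close>; the geometric error bound
    feeds Borel-Cantelli.\<close>
  have "\<forall>r. \<exists>a. (\<forall>k<N. a k \<le> b) \<and> (\<forall>p\<in>T \<times> {z, s}. measure M {\<omega>\<in>space M. (1/2) ^ r <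
      norm (corner_sum N a (\<lambda>u. Z (idx_add u (snd p)) \<omega>) (fst p) - Z (idx_add (fst p) (snd p)) \<omega>)} < (1/2) ^ r)"
    using T s z
    by (intro allI corner_sum_approx[where Z = "\<lambda>p u. Z (idx_add u (snd p))" and t = fst and N = N]
        vanishing_field_shift[OF vanishing_Z]) auto
  then obtain a where a: "\<forall>r. (\<forall>k<N. a r k \<le> b) \<and> (\<forall>p\<in>T \<times> {z, s}. measure M {\<omega>\<in>space M. (1/2) ^ r <
      norm (corner_sum N (a r) (\<lambda>u. Z (idx_add u (snd p)) \<omega>) (fst p) - Z (idx_add (fst p) (snd p)) \<omega>)} < (1/2) ^ r)"
    by (rule choice[THEN exE])
  have small: "measure M {\<omega>\<in>space M. (1/2) ^ r <
      norm (corner_sum N (a r) (\<lambda>v. Z (idx_add v u) \<omega>) t - Z (idx_add t u) \<omega>)} < (1/2) ^ r"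
    if "t \<in> T" "u \<in> {z, s}" for r t u
    using a[rule_format, THEN conjunct2, rule_format, of "(t, u)" r] that by simp
  \<comment> \<open>Multiplying the box sum by \<open>mexp (- tTheta N Th (idx_add t u))\<close>
    cancels the shift in the weights: they depend on \<open>idx_diff j t\<close> only, and
    \<open>u\<close> enters through the increments of \<open>G\<close> alone.\<close>
  define V where "V r u t \<omega> = (\<Sum>j\<in>lower_box N (a r) t. mexp (tTheta N Th (idx_diff j t)) *v
      Delta N G (idx_add j u) \<omega>)" for r :: nat and u t \<omega>
  have box_ZN: "lower_box N (a r) t \<subseteq> ZN N" if "t \<in> T" for r t
    using T that by (intro lower_box_subset_ZN) auto
  have V_measurable: "V r u t \<in> borel_measurable M" if "t \<in> T" "u \<in> {z, s}" for r u t
    unfolding V_def[abs_def] using that box_ZN[OF that(1)] s z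
    by (intro borel_measurable_sum borel_measurable_matrix_vector_mult Delta_G_measurable idx_add_in_ZN) auto
  have V_lim: "AE \<omega> in M. (\<lambda>r. V r u t \<omega>) \<longlonglongrightarrow> X (idx_add t u) \<omega>" if t: "t \<in> T" and u: "u \<in> {z, s}" for t u
  proof -
    have tu: "t \<in> ZN N" "u \<in> ZN N" using t u T s z by auto
    let ?C = "\<lambda>r \<omega>. corner_sum N (a r) (\<lambda>v. Z (idx_add v u) \<omega>) t"
    have "AE \<omega> in M. (\<lambda>r. ?C r \<omega> - Z (idx_add t u) \<omega>) \<longlonglongrightarrow> 0"
    proof (rule AE_tendsto_0_geometric)
      show "(\<lambda>\<omega>. ?C r \<omega> - Z (idx_add t u) \<omega>) \<in> borel_measurable M" for r
        using Z_measurable tu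
        by (intro borel_measurable_diff corner_sum_measurable[where N = N]) (auto simp: idx_add_in_ZN)
    qed (rule less_imp_le[OF small[OF t u]])
    moreover have "AE \<omega> in M. \<forall>r. ?C r \<omega> = (\<Sum>j\<in>lower_box N (a r) t.
        mexp (tTheta N Th (idx_add j u)) *v Delta N G (idx_add j u) \<omega>)"
      unfolding AE_all_countable
    proof
      fix r
      have "\<forall>k<N. a r k \<le> t k"
      proof (intro allI impI)
        fix k assume k: "k < N"
        then have "a r k \<le> b" using a by blast
        with b[OF t k] show "a r k \<le> t k" by simp
      qed
      with tu show "AE \<omega> in M. ?C r \<omega> = (\<Sum>j\<in>lower_box N (a r) t.
          mexp (tTheta N Th (idx_add j u)) *v Delta N G (idx_add j u) \<omega>)"
        by (rule AE_corner_sum_Z)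
    qed
    ultimately show ?thesis
    proof eventually_elim
      case (elim \<omega>)
      let ?A = "mexp (- tTheta N Th (idx_add t u))"
      have "idx_diff (idx_add j u) (idx_add t u) = idx_diff j t" for j
        by (auto simp: idx_diff_def idx_add_def)
      then have "?A ** mexp (tTheta N Th (idx_add j u)) = mexp (tTheta N Th (idx_diff j t))" for j
        using mexp_tTheta_diff(2)[OF commuting, of "idx_add j u" "idx_add t u"] by simp
      then have "V r u t \<omega> = ?A *v ?C r \<omega>" for r
        using elim(2) by (simp add: V_def matrix_vector_mult_sum_right matrix_vector_mul_assoc)
      moreover have "(\<lambda>r. ?A *v ?C r \<omega>) \<longlonglongrightarrow> ?A *v Z (idx_add t u) \<omega>"
        using elim(1) by (intro bounded_linear.tendsto[OF matrix_vector_mul_bounded_linear]) (simp add: LIM_zero_iff)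
      ultimately show ?case by (simp add: X_eq_Z)
    qed
  qed
  show "distr M (PiM T (\<lambda>_. borel)) (\<lambda>\<omega>. restrict (\<lambda>t. X (idx_add t s) \<omega>) T) =
      distr M (PiM T (\<lambda>_. borel)) (\<lambda>\<omega>. restrict (\<lambda>t. X t \<omega>) T)"
  proof (rule distr_PiM_eqI_continuous[OF \<open>finite T\<close>])
    show "X (idx_add t s) \<in> borel_measurable M" "X t \<in> borel_measurable M" if "t \<in> T" for t
      using that T s by (auto intro!: X_measurable idx_add_in_ZN)
    fix f :: "(nat \<Rightarrow> int) \<Rightarrow> real^'n \<Rightarrow> real"
    assume cont: "\<And>t. continuous_on UNIV (f t)" and bound: "\<And>t x. 0 \<le> f t x \<and> f t x \<le> 1"
    have f_measurable: "f t \<in> borel_measurable borel" for t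
      using cont by (rule borel_measurable_continuous_onI)
    have lim: "(\<lambda>r. \<integral>\<omega>. (\<Prod>t\<in>T. f t (V r u t \<omega>)) \<partial>M) \<longlonglongrightarrow> (\<integral>\<omega>. (\<Prod>t\<in>T. f t (X (idx_add t u) \<omega>)) \<partial>M)"
      if u: "u \<in> {z, s}" for u
    proof (rule integral_dominated_convergence[where w = "\<lambda>_. 1"])
      show "(\<lambda>\<omega>. \<Prod>t\<in>T. f t (X (idx_add t u) \<omega>)) \<in> borel_measurable M"
        using T s z u
        by (intro borel_measurable_prod measurable_compose[OF X_measurable f_measurable] idx_add_in_ZN) auto
      show "(\<lambda>\<omega>. \<Prod>t\<in>T. f t (V r u t \<omega>)) \<in> borel_measurable M" for r
        by (intro borel_measurable_prod measurable_compose[OF V_measurable[OF _ u] f_measurable])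
      show "AE \<omega> in M. norm (\<Prod>t\<in>T. f t (V r u t \<omega>)) \<le> 1" for r
        using bound by (auto simp: abs_prod intro!: AE_I2 prod_le_1)
      have "AE \<omega> in M. \<forall>t\<in>T. (\<lambda>r. V r u t \<omega>) \<longlonglongrightarrow> X (idx_add t u) \<omega>"
        using V_lim u by (intro AE_finite_allI \<open>finite T\<close>)
      then show "AE \<omega> in M. (\<lambda>r. \<Prod>t\<in>T. f t (V r u t \<omega>)) \<longlonglongrightarrow> (\<Prod>t\<in>T. f t (X (idx_add t u) \<omega>))"
      proof eventually_elim
        case (elim \<omega>)
        show ?case
        proof (rule tendsto_prod)
          fix t assume "t \<in> T"
          with elim show "(\<lambda>r. f t (V r u t \<omega>)) \<longlonglongrightarrow> f t (X (idx_add t u) \<omega>)"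
            by (intro continuous_on_tendsto_compose[OF cont]) auto
        qed
      qed
    qed simp
    have "(\<integral>\<omega>. (\<Prod>t\<in>T. f t (V r s t \<omega>)) \<partial>M) = (\<integral>\<omega>. (\<Prod>t\<in>T. f t (V r z t \<omega>)) \<partial>M)" for r
    proof -
      \<comment> \<open>\<open>J\<close> collects the finitely many indices involved, and
        \<open>h\<close> is one functional of the increments on \<open>J\<close> for both shifts.
        Stationarity of the increments therefore equates the two integrals.\<close>
      define J where "J = (\<Union>t\<in>T. lower_box N (a r) t)"
      define h where "h x = (\<Prod>t\<in>T. f t (\<Sum>j\<in>lower_box N (a r) t. mexp (tTheta N Th (idx_diff j t)) *v x j))" for x
      have J: "finite J" "J \<subseteq> ZN N"
        unfolding J_def using T box_ZN by (auto intro: finite_lower_box)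
      have "h \<in> borel_measurable (PiM J (\<lambda>_. borel))"
        unfolding h_def[abs_def]
      proof (intro borel_measurable_prod measurable_compose[OF _ f_measurable] borel_measurable_sum
          borel_measurable_matrix_vector_mult)
        fix t j assume "t \<in> T" "j \<in> lower_box N (a r) t"
        then have "j \<in> J" by (auto simp: J_def)
        then show "(\<lambda>x. x j) \<in> borel_measurable (PiM J (\<lambda>_. borel))"
          by (rule measurable_component_singleton)
      qed
      then have law: "(\<integral>x. h x \<partial>distr M (PiM J (\<lambda>_. borel)) (\<lambda>\<omega>. restrict (\<lambda>j. Delta N G (idx_add j u) \<omega>) J))
          = (\<integral>\<omega>. (\<Prod>t\<in>T. f t (V r u t \<omega>)) \<partial>M)" if "u \<in> {z, s}" for u
      proof (subst integral_distr)
        show "(\<lambda>\<omega>. restrict (\<lambda>j. Delta N G (idx_add j u) \<omega>) J) \<in> measurable M (PiM J (\<lambda>_. borel))"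
          using J that s z by (intro measurable_restrict Delta_G_measurable idx_add_in_ZN) auto
        have "h (restrict (\<lambda>j. Delta N G (idx_add j u) \<omega>) J) = (\<Prod>t\<in>T. f t (V r u t \<omega>))" for \<omega>
          unfolding h_def V_def
          by (intro prod.cong refl arg_cong[of _ _ "f _"] sum.cong) (auto simp: J_def)
        then show "(\<integral>\<omega>. h (restrict (\<lambda>j. Delta N G (idx_add j u) \<omega>) J) \<partial>M) = (\<integral>\<omega>. (\<Prod>t\<in>T. f t (V r u t \<omega>)) \<partial>M)"
          by simp
      qed
      have "distr M (PiM J (\<lambda>_. borel)) (\<lambda>\<omega>. restrict (\<lambda>j. Delta N G (idx_add j s) \<omega>) J) =
          distr M (PiM J (\<lambda>_. borel)) (\<lambda>\<omega>. restrict (\<lambda>j. Delta N G (idx_add j z) \<omega>) J)"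
        using assms s J unfolding stat_incr_def eq_law_def add_z by blast
      then show ?thesis using law[of s] law[of z] by simp
    qed
    then show "(\<integral>\<omega>. (\<Prod>t\<in>T. f t (X (idx_add t s) \<omega>)) \<partial>M) = (\<integral>\<omega>. (\<Prod>t\<in>T. f t (X t \<omega>)) \<partial>M)"
      using lim[of s] lim[of z] by (intro LIMSEQ_unique[OF lim[of s]]) simp_all
  qed
qed

end

text \<open>Limits in probability are determined only up to null sets, hence the representation is
  an almost sure equality for every version \<open>Y\<close> of the iterated limit. That a version
  exists is part of \<open>G_class\<close>.\<close>

theorem mainTheorem10:
  fixes M :: "'a measure" and N :: nat
    and Th :: "nat \<Rightarrow> real^'n^'n"
    and X G :: "(nat \<Rightarrow> int) \<Rightarrow> 'a \<Rightarrow> real^'n"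
  assumes "prob_space M"
    and "\<forall>j<N. sym_posdef (Th j)"
    and "\<forall>i<N. \<forall>j<N. Th i ** Th j = Th j ** Th i"
    and "\<forall>t\<in>ZN N. X t \<in> borel_measurable M"
    and "\<forall>t\<in>ZN N. G t \<in> borel_measurable M"
    and "\<forall>j<N. \<forall>t\<in>ZN N.
           conv_prob M (\<lambda>k \<omega>. mexp (real_of_int (- int k) *\<^sub>R Th j) *v X (t(j := - int k)) \<omega>) (\<lambda>_. 0)"
    and "G_class M N Th G"
    and "\<forall>t\<in>ZN N. AE \<omega> in M. X t \<omega> =
           (\<Sum>i\<in>BN N - {\<lambda>_. 0}. (- sign_of N i) *\<^sub>R (mexp (- tTheta N Th i) *v X (idx_diff t i) \<omega>))
           + Delta N G t \<omega>"
  shows "stationary M N X \<and>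
         (\<forall>t\<in>ZN N. \<forall>Y. Minv_at M N Th G t Y \<longrightarrow>
            (AE \<omega> in M. X t \<omega> = mexp (- tTheta N Th t) *v Y \<omega>))"
proof -
  interpret prob_space M by fact
  interpret recursive_field M N Th X G
    using assms(3-6,8) by unfold_locales blast+
  show ?thesis
  proof (intro conjI ballI allI impI)
    show "stationary M N X"
      using assms(7) by (intro stationary_X) (simp add: G_class_def)
    fix t Y assume "t \<in> ZN N" "Minv_at M N Th G t Y"
    then have "AE \<omega> in M. Z t \<omega> = Y \<omega>" by (rule AE_Minv_eq)
    then show "AE \<omega> in M. X t \<omega> = mexp (- tTheta N Th t) *v Y \<omega>"
      by eventually_elim (simp add: X_eq_Z)
  qed
qed

end
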